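(* Let $w_1,\dots,w_N$ be classical scalar weights of the same type (shifted Hermite, Laguerre, or Jacobi), let $\delta_j$ be the second-order operator associated with $w_j$, and let $W=w_1\oplus\cdots\oplus w_N$. The eigenvalue algebra $\Lambda(W)$ is given by $$\Lambda(W)=\sum_{i,j=1}^N\Lambda_n(\mathcal T_{w_i,w_j})\,\mathbb C[\Lambda_n(\delta_j)]\,E_{i,j}\subset\operatorname{Mat}_N(\mathbb C[n]),$$ where $E_{i,j}$ are the matrix units, $\mathbb C[\Lambda_n(\delta_j)]=\mathbb C[n]$ if $w_j$ is a Hermite or Laguerre weight, $\mathbb C[\Lambda_n(\delta_j)]=\mathbb C[n(n+\alpha+\beta+1)]$ if $w_j=w_{\alpha,\beta}$ is a Jacobi weight, and: (i) $\Lambda_n(\mathcal T_{w_j,w_j})=1$, and $\Lambda_n(\mathcal T_{w_1,w_2})=0$ if $w_1$ is not a Darboux transformation of $w_2$. (ii) For Laguerre weights $w_\alpha$ and $k\in\mathbb N$, $\Lambda_n(\mathcal T_{w_\alpha,w_{\alpha+k}})=1$ and $\Lambda_n(\mathcal T_{w_{\alpha+k},w_\alpha})=\dfrac{\Gamma(n+\alpha+k+1)}{\Gamma(n+\alpha+1)}$. (iii) For Jacobi weights $w_{\alpha,\beta}$ and $k\in\mathbb N$, $\Lambda_n(\mathcal T_{w_{\alpha,\beta+k},w_{\alpha+k,\beta}})=\dfrac{\Gamma(n+\beta+k+1)}{\Gamma(n+\beta+1)}$ and $\Lambda_n(\mathcal T_{w_{\alpha+k,\beta},w_{\alpha,\b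eta+k}})=\dfrac{\Gamma(n+\alpha+k+1)}{\Gamma(n+\alpha+1)}$.
   Context: For a weight matrix $W$ of size $N$ (smooth, positive definite a.e. on an interval, finite moments), $\{P_n\}$ denotes the monic matrix polynomials orthogonal for $\langle P,Q\rangle_W=\int P(x)W(x)Q(x)^*dx$. Differential operators $D=\sum_{j}\partial^jF_j(x)$ with polynomial (matrix) coefficients, forming the algebra $\operatorname{Mat}_N(\Omega[x])$, act on the right: $P\cdot D=\sum_j\partial^j(P)F_j$, and $P\cdot(D_1D_2)=(P\cdot D_1)\cdot D_2$. $\mathcal D(W)=\{D\in\operatorname{Mat}_N(\Omega[x]):\text{for all }n\ge0,\ P_n\cdot D=\Lambda_n(D)P_n\text{ for some }\Lambda_n(D)\in\operatorname{Mat}_N(\mathbb C)\}$. For any operator $D=\sum_{i=0}^m\partial^iF_i$ with $F_i(x)=\sum_{j=0}^ix^jF^i_j$ (so $\deg F_i\le i$; this holds for all elements of $\mathcal D(W)$ and for the scalar operators $\mathcal T$ below), $\Lambda_n(D)=\sum_{i=0}^m[n]_iF^i_i$, $[n]_i=n(n-1)\cdots(n-i+1)$, $[n]_0=1$. It is a polynomial in $n$, denoted $\Lambda(D)$ as an element of $\operatorname{Mat}_N(\mathbb C[n])$. The eigenvalue algebra is $\Lambda(W)=\{\Lambda(D):D\in\mathcal D(W)\}$. Classical scalar weights and their second-order operators: shifted Hermite $w_b(x)=e^{-x^2+2bx}$ on $(-\infty,\infty)$, $\delta=\partial^2-2\partial(x-b)$; Laguerre $w_\alpha(x)=e^{-x}x^\alpha$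 on $(0,\infty)$, $\alpha>-1$, $\delta=\partial^2x+\partial(\alpha+1-x)$; Jacobi $w_{\alpha,\beta}(x)=(1-x)^\alpha(1+x)^\beta$ on $(-1,1)$, $\alpha,\beta>-1$, $\delta=\partial^2(1-x^2)+\partial(\beta-\alpha-x(\alpha+\beta+2))$. Their eigenvalues on monic orthogonal polynomials are $\Lambda_n(\delta)=-2n$, $-n$, $-n(n+\alpha+\beta+1)$ respectively. Darboux transformations: an operator is degree-preserving if $\deg(P\cdot\mathcal V)=\deg P$ for all polynomials $P$; $\tilde w$ is a Darboux transformation of $w$ (same support, monic orthogonal polynomials $\tilde p_n$, $p_n$) if some $D\in\mathcal D(w)$ factors as $D=\mathcal V\mathcal N$ with $\mathcal V,\mathcal N$ degree-preserving operators with polynomial coefficients and $p_n\cdot\mathcal V=a_n\tilde p_n$, $a_n\in\mathbb C$, for all $n\ge0$. For classical weights: $w_a,w_b$ shifted Hermite are equivalent iff $a=b$; Laguerre $w_\alpha,w_{\tilde\alpha}$ iff $\alpha-\tilde\alpha\in\mathbb Z$; Jacobi $w_{\alpha,\beta},w_{\tilde\alpha,\tilde\beta}$ iff $\alpha+\beta=\tilde\alpha+\tilde\beta$ and $\alpha-\tilde\alpha\in\mathbb Z$. The operators $\mathcal T_{w,\tilde w}$: $\mathcal T_{w,\tilde w}=1$ if $w=\tilde w$, and $\mathcal T_{w,\tilde w}=0$ if $w$ is not a Darboux transformation of $\tilde w$. For Laguerre weights and $k\in\mathbb N$: $\mathcal T_{w_\alpha,w_{\alpha+k}}=(-\partial+1)^k$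 and $\mathcal T_{w_{\alpha+k},w_\alpha}=(\partial x+\alpha+k)\cdots(\partial x+\alpha+1)$. For Jacobi weights and $k\in\mathbb N$: $\mathcal T_{w_{\alpha,\beta+k},w_{\alpha+k,\beta}}=(\partial(1+x)+\beta+k)\cdots(\partial(1+x)+\beta+1)$ and $\mathcal T_{w_{\alpha+k,\beta},w_{\alpha,\beta+k}}=(\partial(x-1)+\alpha+k)\cdots(\partial(x-1)+\alpha+1)$. *)

theory Defs
  imports "HOL-Analysis.Analysis"
begin

section \<open>Scalar differential operators acting on the right\<close>

text \<open>
  The operator $\sum_j \partial^j F_j(x)$ with polynomial coefficients is represented by its
  coefficient sequence: an element \<open>D\<close> of \<open>complex poly poly\<close> with \<open>coeff D j\<close> $= F_j$, so
  that \<open>degree D\<close> is the order. Only the additive structure of \<open>complex poly poly\<close> is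
  that of the operator algebra; its ring multiplication is \<^emph>\<open>not\<close> composition, which is
  \<open>op_comp\<close>. The identity operator is \<open>1\<close>.
\<close>

type_synonym diffop = "complex poly poly"

definition op_act :: "complex poly \<Rightarrow> diffop \<Rightarrow> complex poly" where
  "op_act p D = (\<Sum>j\<le>degree D. (pderiv ^^ j) p * coeff D j)"

text \<open>
  $(\partial^i F)(\partial^j G) = \sum_{l\le j} {j \choose l}\, \partial^{i+j-l} F^{(l)} G$, by the
  Leibniz rule; see \<open>op_act_comp\<close> below.
\<close>

definition op_comp :: "diffop \<Rightarrow> diffop \<Rightarrow> diffop" where
  "op_comp D E = (\<Sum>i\<le>degree D. \<Sum>j\<le>degree E. \<Sum>l\<le>j.
     monom (of_nat (j choose l) * (pderiv ^^ l) (coeff D i) * coeff E j) (i + (j - l)))"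

primrec op_power :: "diffop \<Rightarrow> nat \<Rightarrow> diffop" where
  "op_power D 0 = 1"
| "op_power D (Suc k) = op_comp D (op_power D k)"

text \<open>$(\partial g + c + k)(\partial g + c + k - 1)\cdots(\partial g + c + 1)$\<close>

primrec op_rising :: "complex poly \<Rightarrow> complex \<Rightarrow> nat \<Rightarrow> diffop" where
  "op_rising g c 0 = 1"
| "op_rising g c (Suc k) = op_comp [:[:c + of_nat (Suc k):], g:] (op_rising g c k)"

lemma op_act_le:
  assumes "degree D \<le> n"
  shows "op_act p D = (\<Sum>j\<le>n. (pderiv ^^ j) p * coeff D j)"
  unfolding op_act_def using assms
  by (intro sum.mono_neutral_left) (auto simp: coeff_eq_0)

lemma op_act_add: "op_act p (D + E) = op_act p D + op_act p E"
proof -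
  define n where "n = max (degree D) (degree E)"
  have "degree D \<le> n" "degree E \<le> n" "degree (D + E) \<le> n"
    using degree_add_le_max[of D E] by (auto simp: n_def)
  thus ?thesis by (simp add: op_act_le[of _ n] sum.distrib algebra_simps)
qed

lemma op_act_sum: "op_act p (\<Sum>x\<in>A. f x) = (\<Sum>x\<in>A. op_act p (f x))"
proof (induction A rule: infinite_finite_induct)
  case (insert x A)
  then show ?case by (simp add: op_act_add)
qed (simp_all add: op_act_def)

lemma op_act_monom: "op_act p (monom c m) = (pderiv ^^ m) p * c"
  by (subst op_act_le[of _ m]) (simp_all add: degree_monom_le if_distrib cong: if_cong)

lemma higher_pderiv_mult:
  fixes p q :: "complex poly"
  shows "(pderiv ^^ n) (p * q) =
    (\<Sum>k\<le>n. of_nat (n choose k) * (pderiv ^^ k) p * (pderiv ^^ (n - k)) q)"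
proof (induction n)
  case (Suc n)
  have "(pderiv ^^ Suc n) (p * q) =
      (\<Sum>k\<le>n. pderiv (of_nat (n choose k) * (pderiv ^^ k) p * (pderiv ^^ (n - k)) q))"
    by (simp add: Suc.IH higher_pderiv_sum[of 1, simplified])
  also have "\<dots> = (\<Sum>k\<le>n. of_nat (n choose k) * (pderiv ^^ Suc k) p * (pderiv ^^ (n - k)) q)
      + (\<Sum>k\<le>n. of_nat (n choose k) * (pderiv ^^ k) p * (pderiv ^^ (Suc n - k)) q)"
    unfolding sum.distrib[symmetric]
    by (intro sum.cong refl) (simp add: pderiv_mult Suc_diff_le algebra_simps)
  also have "(\<Sum>k\<le>n. of_nat (n choose k) * (pderiv ^^ k) p * (pderiv ^^ (Suc n - k)) q)
      = (\<Sum>k\<le>Suc n. of_nat (n choose k) * (pderiv ^^ k) p * (pderiv ^^ (Suc n - k)) q)"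
    by (simp add: binomial_eq_0)
  also have "\<dots> = p * (pderiv ^^ Suc n) q +
      (\<Sum>k\<le>n. of_nat (n choose Suc k) * (pderiv ^^ Suc k) p * (pderiv ^^ (n - k)) q)"
    by (subst sum.atMost_Suc_shift) simp
  finally show ?case
    by (subst sum.atMost_Suc_shift) (simp add: sum.distrib algebra_simps)
qed simp

lemma op_act_comp: "op_act p (op_comp D E) = op_act (op_act p D) E"
proof -
  have "op_act (op_act p D) E = (\<Sum>j\<le>degree E. \<Sum>i\<le>degree D. \<Sum>l\<le>j.
      of_nat (j choose l) * (pderiv ^^ (i + (j - l))) p * (pderiv ^^ l) (coeff D i) * coeff E j)"
  proof -
    have "(pderiv ^^ j) ((pderiv ^^ i) p * coeff D i) = (\<Sum>l\<le>j.
       of_nat (j choose l) * (pderiv ^^ (i + (j - l))) p * (pderiv ^^ l) (coeff D i))" for i j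
      by (subst mult.commute, subst higher_pderiv_mult)
         (simp add: funpow_add[symmetric, unfolded o_def, THEN fun_cong] add.commute
            funpow_add mult_ac)
    thus ?thesis
      unfolding op_act_def by (simp add: higher_pderiv_sum sum_distrib_right)
  qed
  also have "\<dots> = op_act p (op_comp D E)"
    unfolding op_comp_def op_act_sum op_act_monom
    by (subst sum.swap) (simp add: mult_ac)
  finally show ?thesis by simp
qed

text \<open>
  With the convention $\deg 0 = -\infty$, preserving degrees includes mapping nonzero constants
  to nonzero constants; as \<open>degree 0 = 0\<close> here, this has to be required separately.
\<close>

definition degree_preserving :: "diffop \<Rightarrow> bool" where
  "degree_preserving V \<longleftrightarrow>
    (\<forall>p. p \<noteq> 0 \<longrightarrow> op_act p V \<noteq> 0 \<and> degree (op_act p V) = degree p)"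

text \<open>$[n]_i = n(n-1)\cdots(n-i+1)$ as a polynomial in $n$\<close>

definition falling_poly :: "nat \<Rightarrow> complex poly" where
  "falling_poly i = (\<Prod>k<i. [:- of_nat k, 1:])"

text \<open>$\Lambda_n(D) = \sum_i [n]_i F^i_i$ as an element of $\mathbb C[n]$\<close>

definition eigval :: "diffop \<Rightarrow> complex poly" where
  "eigval D = (\<Sum>i\<le>degree D. smult (coeff (coeff D i) i) (falling_poly i))"


section \<open>Scalar weights and Darboux transformations\<close>

text \<open>Weights are functions on the whole real line, extended by zero outside their interval.\<close>

definition monic_ops :: "(real \<Rightarrow> real) \<Rightarrow> (nat \<Rightarrow> complex poly) \<Rightarrow> bool" where
  "monic_ops w p \<longleftrightarrow>
    (\<forall>n. degree (p n) = n \<and> lead_coeff (p n) = 1) \<and>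
    (\<forall>m n. m \<noteq> n \<longrightarrow>
      (LINT x|lborel. poly (p m) (of_real x) * of_real (w x) * cnj (poly (p n) (of_real x))) = 0)"

definition ops :: "(real \<Rightarrow> real) \<Rightarrow> nat \<Rightarrow> complex poly" where
  "ops w = (THE p. monic_ops w p)"

definition Dalg :: "(real \<Rightarrow> real) \<Rightarrow> diffop set" where
  "Dalg w = {D. \<forall>n. \<exists>c. op_act (ops w n) D = smult c (ops w n)}"

text \<open>\<open>darboux w' w\<close>: the weight \<open>w'\<close> is a Darboux transformation of \<open>w\<close>.\<close>

definition darboux :: "(real \<Rightarrow> real) \<Rightarrow> (real \<Rightarrow> real) \<Rightarrow> bool" where
  "darboux w' w \<longleftrightarrow>
    closure {x. w' x \<noteq> 0} = closure {x. w x \<noteq> 0} \<and>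
    (\<exists>D\<in>Dalg w. \<exists>V N. degree_preserving V \<and> degree_preserving N \<and> D = op_comp V N \<and>
      (\<forall>n. \<exists>a. op_act (ops w n) V = smult a (ops w' n)))"


section \<open>Classical scalar weights\<close>

datatype classical = Hermite real | Laguerre real | Jacobi real real

fun weight :: "classical \<Rightarrow> real \<Rightarrow> real" where
  "weight (Hermite b) x = exp (- (x\<^sup>2) + 2 * b * x)"
| "weight (Laguerre \<alpha>) x = (if 0 < x then exp (- x) * x powr \<alpha> else 0)"
| "weight (Jacobi \<alpha> \<beta>) x =
    (if -1 < x \<and> x < 1 then (1 - x) powr \<alpha> * (1 + x) powr \<beta> else 0)"

fun admissible :: "classical \<Rightarrow> bool" where
  "admissible (Hermite b) \<longleftrightarrow> True"
| "admissible (Laguerre \<alpha>) \<longleftrightarrow> \<alpha> > -1"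
| "admissible (Jacobi \<alpha> \<beta>) \<longleftrightarrow> \<alpha> > -1 \<and> \<beta> > -1"

fun same_type :: "classical \<Rightarrow> classical \<Rightarrow> bool" where
  "same_type (Hermite _) (Hermite _) \<longleftrightarrow> True"
| "same_type (Laguerre _) (Laguerre _) \<longleftrightarrow> True"
| "same_type (Jacobi _ _) (Jacobi _ _) \<longleftrightarrow> True"
| "same_type _ _ \<longleftrightarrow> False"

text \<open>The coefficients are listed in increasing order of the derivative.\<close>

fun delta :: "classical \<Rightarrow> diffop" where
  "delta (Hermite b) = [:0, [:2 * of_real b, -2:], 1:]"
| "delta (Laguerre \<alpha>) = [:0, [:of_real \<alpha> + 1, -1:], [:0, 1:]:]"
| "delta (Jacobi \<alpha> \<beta>) =
    [:0, [:of_real \<beta> - of_real \<alpha>, - (of_real \<alpha> + of_real \<beta> + 2):], [:1, 0, -1:]:]"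

text \<open>
  The operators $\mathcal T_{w,\tilde w}$. Distinct admissible parameters give distinct weight
  functions, so \<open>u = v\<close> is equality of weights. In the \<open>Laguerre\<close> case the two branches are
  the weight pairs $(w_a, w_{a+k})$ and $(w_{a'+k}, w_{a'})$; in the \<open>Jacobi\<close> case they are
  $(w_{a,b'+k}, w_{a+k,b'})$ and $(w_{a'+k,b}, w_{a',b+k})$. Two distinct classical weights related
  by a Darboux transformation are always of one of these forms, so the remaining alternatives
  (value 0) never arise for admissible weights.
\<close>

definition T_op :: "classical \<Rightarrow> classical \<Rightarrow> diffop" where
  "T_op u v =
    (if u = v then 1
     else if \<not> darboux (weight u) (weight v) then 0
     else (case (u, v) of
        (Laguerre a, Laguerre a') \<Rightarrow>
          if a' - a \<in> \<nat> then op_power [:1, -1:] (nat \<lfloor>a' - a\<rfloor>)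
          else if a - a' \<in> \<nat> then op_rising [:0, 1:] (of_real a') (nat \<lfloor>a - a'\<rfloor>)
          else 0
      | (Jacobi a b, Jacobi a' b') \<Rightarrow>
          if a + b = a' + b' \<and> a' - a \<in> \<nat>
            then op_rising [:1, 1:] (of_real b') (nat \<lfloor>a' - a\<rfloor>)
          else if a + b = a' + b' \<and> a - a' \<in> \<nat>
            then op_rising [:-1, 1:] (of_real a') (nat \<lfloor>a - a'\<rfloor>)
          else 0
      | _ \<Rightarrow> 0))"


section \<open>Matrix weights and the eigenvalue algebra\<close>

text \<open>
  Matrix polynomials are matrices of polynomials. As in the scalar case, a differential operator
  with matrix coefficients is given by its coefficient sequence (only the zero of the type of
  matrices is needed to form \<open>poly\<close>).
\<close>

type_synonym 'n mpoly = "complex poly ^ 'n ^ 'n"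
type_synonym 'n mdiffop = "(complex poly ^ 'n ^ 'n) poly"

definition mop_act :: "'n::finite mpoly \<Rightarrow> 'n mdiffop \<Rightarrow> 'n mpoly" where
  "mop_act P D = (\<Sum>j\<le>degree D. (\<chi> a b. (pderiv ^^ j) (P $ a $ b)) ** coeff D j)"

definition mp_eval :: "'n::finite mpoly \<Rightarrow> real \<Rightarrow> complex ^ 'n ^ 'n" where
  "mp_eval P x = (\<chi> a b. poly (P $ a $ b) (of_real x))"

definition mp_const :: "complex ^ 'n ^ 'n \<Rightarrow> 'n::finite mpoly" where
  "mp_const L = (\<chi> a b. [:L $ a $ b:])"

definition adjoint_mat :: "complex ^ 'n ^ 'n \<Rightarrow> complex ^ 'n ^ 'n" where
  "adjoint_mat A = (\<chi> a b. cnj (A $ b $ a))"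

definition mp_inner ::
    "(real \<Rightarrow> complex ^ 'n ^ 'n) \<Rightarrow> 'n::finite mpoly \<Rightarrow> 'n mpoly \<Rightarrow> complex ^ 'n ^ 'n" where
  "mp_inner W P Q = (LINT x|lborel. mp_eval P x ** W x ** adjoint_mat (mp_eval Q x))"

definition monic_mops ::
    "(real \<Rightarrow> complex ^ 'n ^ 'n) \<Rightarrow> (nat \<Rightarrow> 'n::finite mpoly) \<Rightarrow> bool" where
  "monic_mops W P \<longleftrightarrow>
    (\<forall>n a b. degree (P n $ a $ b) \<le> n \<and> coeff (P n $ a $ b) n = (if a = b then 1 else 0)) \<and>
    (\<forall>m n. m \<noteq> n \<longrightarrow> mp_inner W (P m) (P n) = 0)"

definition mops :: "(real \<Rightarrow> complex ^ 'n ^ 'n) \<Rightarrow> nat \<Rightarrow> 'n::finite mpoly" where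
  "mops W = (THE P. monic_mops W P)"

definition mDalg :: "(real \<Rightarrow> complex ^ 'n ^ 'n) \<Rightarrow> 'n::finite mdiffop set" where
  "mDalg W = {D. \<forall>n. \<exists>L. mop_act (mops W n) D = mp_const L ** mops W n}"

definition meigval :: "'n::finite mdiffop \<Rightarrow> 'n mpoly" where
  "meigval D =
    (\<chi> a b. \<Sum>i\<le>degree D. smult (coeff (coeff D i $ a $ b) i) (falling_poly i))"

definition eigenvalue_algebra :: "(real \<Rightarrow> complex ^ 'n ^ 'n) \<Rightarrow> 'n::finite mpoly set" where
  "eigenvalue_algebra W = meigval ` mDalg W"

definition direct_sum :: "('n \<Rightarrow> real \<Rightarrow> real) \<Rightarrow> real \<Rightarrow> complex ^ 'n ^ 'n" where
  "direct_sum w x = (\<chi> a b. if a = b then of_real (w a x) else 0)"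

definition matrix_unit :: "'n \<Rightarrow> 'n \<Rightarrow> 'n::finite mpoly" where
  "matrix_unit i j = (\<chi> a b. if a = i \<and> b = j then 1 else 0)"

text \<open>The subalgebra $\mathbb C[p]$ of $\mathbb C[n]$\<close>

definition poly_alg :: "complex poly \<Rightarrow> complex poly set" where
  "poly_alg p = range (\<lambda>q. pcompose q p)"

end

theory Submission
  imports Defs "HOL-Probability.Distributions" "HOL-Real_Asymp.Real_Asymp"
begin

text \<open>
  The weight is a direct sum, so its monic orthogonal polynomials are the diagonal matrices formed
  from the scalar ones, and an operator \<open>D\<close> lies in \<open>mDalg\<close> exactly when every entry
  $D_{ij}$ intertwines two scalar families, $p_n^{w_i} \cdot D_{ij} = c_{ij}(n)\, p_n^{w_j}$
  (\<open>mDalg_direct_sum\<close>). The theorem is therefore a statement about two scalar weights $u$, $v$: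
  the eigenvalues of the intertwiners from $u$ to $v$ are the multiples
  $\Lambda(\mathcal T_{u,v})\, f$ with $f \in \mathbb C[\Lambda(\delta_v)]$
  (\<open>eigval_intertwiners\<close>).

  All of these multiples occur. An operator $T$ with $\delta_u T = T \delta_v$ and
  $\Lambda(\delta_u) = \Lambda(\delta_v)$ is an intertwiner, because eigenpolynomials of $\delta_v$ are
  determined by their eigenvalue. Every factor of $\mathcal T_{u,v}$ satisfies such a commutation
  relation (\<open>rising_step\<close>, \<open>lowering_step_laguerre\<close>). The operators of the two directions are
  degree preserving and so exhibit $u$ and $v$ as Darboux transformations of each other. The remaining
  multiples are obtained by composing with polynomials in $\delta_v$.

  No other eigenvalue occurs, and for Laguerre and Jacobi weights this is seen by evaluating at an
  endpoint $e$ of the support. There the leading coefficient of $\delta_u$ vanishes, so that the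
  eigenvalue equation is a two-term recurrence for the Taylor coefficients of $p_n$ at $e$. Each of them
  is thus $p_n(e)$ times a polynomial in the eigenvalue $\lambda_n$. Evaluating
  $p_n \cdot D = c(n)\, q_n$ at $e$ gives
  \[ c(n)\, q_n(e) = p_n(e)\, d(\lambda_n) \]
  for some polynomial $d$ (\<open>endpoint_identity\<close>). The values at $e$ are known explicitly, and if
  $\delta_u$ and $\delta_v$ have the same eigenvalues, then $p_n(e)/q_n(e)$ is a quotient of two
  Pochhammer symbols whose parameters are the exponents of the weights at $e$ plus one. There are three
  cases.
  \<^item> If the exponents differ by an integer, the quotient is a constant times
    $\Lambda_n(\mathcal T_{u,v})$ or a constant divided by $\Lambda_n(\mathcal T_{v,u})$. Choosing the endpoint suitably for
    Jacobi weights leads to the first alternative (\<open>rising_factor\<close>). For Laguerre weights in the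
    second alternative $\Lambda(\mathcal T_{u,v}) = 1$ and every polynomial in $n$ is allowed.
  \<^item> If they do not differ by an integer, the quotient is not a rational function of $n$, hence
    $c = 0$ (\<open>pochhammer_ratio_rational\<close>).
  \<^item> If Jacobi weights have different sums of exponents, then $D\delta_v$ is a second intertwiner, and
    it shows that also $n\, d(\lambda_n)$ is a polynomial in $\lambda_n$. As $\lambda_n$ has degree $2$ in
    $n$, this forces $d = 0$ (\<open>quadratic_parity\<close>).

  For Hermite weights there is no endpoint. Here $q_n$ is a translate of $p_n$, so an intertwiner of two different
  weights is a differential operator followed by a nontrivial translation; such a composition is not a differential
  operator of finite order unless it vanishes (\<open>hermite_intertwiner_zero\<close>).

  The analytic input is that polynomials are integrable against the weights, that the inner product is
  definite, and the Pearson equation $\int (p'\Phi + p\Psi)\,w = 0$ for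
  $\delta = \partial^2\Phi + \partial\Psi$, which makes $\delta$ symmetric. Together they identify the
  orthogonal polynomials with the eigenpolynomials of $\delta$.
\<close>

section \<open>The right action of differential operators on polynomials\<close>

lemma op_act_zero_left [simp]: "op_act 0 D = 0"
  by (simp add: op_act_def)

lemma op_act_zero_right [simp]: "op_act p 0 = 0"
  by (simp add: op_act_def)

lemma op_act_add_left: "op_act (p + q) D = op_act p D + op_act q D"
  by (simp add: op_act_def higher_pderiv_add algebra_simps sum.distrib)

lemma smult_sum: "smult c (\<Sum>x\<in>A. f x) = (\<Sum>x\<in>A. smult c (f x))"
  by (induction A rule: infinite_finite_induct) (simp_all add: smult_add_right)

lemma op_act_smult_left: "op_act (smult c p) D = smult c (op_act p D)"
  by (simp add: op_act_def higher_pderiv_smult smult_sum)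

lemma op_act_diff_left: "op_act (p - q) D = op_act p D - op_act q D"
  using op_act_add_left[of "p - q" q D] by simp

lemma op_act_one [simp]: "op_act p 1 = p"
  by (simp add: op_act_def)

lemma op_act_const: "op_act p [:F:] = p * F"
  by (simp add: op_act_def)

lemma op_act_order1: "op_act p [:F, G:] = p * F + pderiv p * G"
  by (subst op_act_le[where n = 1]) auto

lemma op_act_order2: "op_act p [:F, G, H:] = p * F + pderiv p * G + pderiv (pderiv p) * H"
  by (subst op_act_le[where n = 2]) (auto simp: numeral_2_eq_2)

text \<open>
  Polynomials of degree below $m$ are spanned by any family with one member of each degree below $m$.
  Vanishing of the coefficients from $m$ on is used in place of a degree bound so that \<open>m = 0\<close> means
  \<open>p = 0\<close>.
\<close>

lemma poly_graded_induct:
  fixes b :: "nat \<Rightarrow> 'a :: field poly"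
  assumes deg: "\<And>n. n < m \<Longrightarrow> b n \<noteq> 0 \<and> degree (b n) = n"
    and zero: "Q 0"
    and basis: "\<And>n. n < m \<Longrightarrow> Q (b n)"
    and add: "\<And>p q. Q p \<Longrightarrow> Q q \<Longrightarrow> Q (p + q)"
    and smult: "\<And>c p. Q p \<Longrightarrow> Q (smult c p)"
    and p: "\<forall>k\<ge>m. coeff p k = 0"
  shows "Q p"
  using deg basis p
proof (induction m arbitrary: p)
  case 0
  have "p = 0" using 0(3) by (simp add: poly_eq_iff)
  thus ?case using zero by simp
next
  case (Suc m)
  define c where "c = coeff p m / coeff (b m) m"
  have deg_m: "b m \<noteq> 0" "degree (b m) = m"
    using Suc.prems(1)[OF lessI] by blast+
  hence bm: "coeff (b m) m \<noteq> 0"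
    using leading_coeff_neq_0[of "b m"] by simp
  have "\<forall>k\<ge>m. coeff (p - smult c (b m)) k = 0"
  proof (intro allI impI)
    fix k assume "k \<ge> m"
    show "coeff (p - smult c (b m)) k = 0"
    proof (cases "k = m")
      case True
      thus ?thesis using bm by (simp add: c_def)
    next
      case False
      hence "coeff (b m) k = 0" "coeff p k = 0"
        using \<open>k \<ge> m\<close> deg_m Suc.prems(3) by (auto intro: coeff_eq_0)
      thus ?thesis by simp
    qed
  qed
  with Suc.IH Suc.prems(1,2) less_SucI have "Q (p - smult c (b m))"
    by blast
  moreover have "Q (smult c (b m))"
    by (intro smult Suc.prems(2) lessI)
  ultimately have "Q ((p - smult c (b m)) + smult c (b m))"
    by (rule add)
  thus "Q p" by simp
qed

lemma poly_basis_induct: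
  fixes b :: "nat \<Rightarrow> 'a :: field poly"
  assumes deg: "\<And>n. b n \<noteq> 0 \<and> degree (b n) = n"
    and basis: "\<And>n. Q (b n)"
    and add: "\<And>p q. Q p \<Longrightarrow> Q q \<Longrightarrow> Q (p + q)"
    and smult: "\<And>c p. Q p \<Longrightarrow> Q (smult c p)"
  shows "Q p"
proof (rule poly_graded_induct[where m = "Suc (degree p)" and b = b and Q = Q])
  show "Q 0"
    using smult[OF basis, of 0] by simp
  show "\<forall>k\<ge>Suc (degree p). coeff p k = 0"
    by (simp add: coeff_eq_0)
  show "b n \<noteq> 0 \<and> degree (b n) = n" for n
    by (rule deg)
  show "Q (b n)" for n
    by (rule basis)
  show "Q (p + q)" if "Q p" "Q q" for p q
    using that by (rule add)
  show "Q (smult c p)" if "Q p" for c p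
    using that by (rule smult)
qed

text \<open>
  For every operator whose action does not raise degrees the coefficients satisfy $\deg F_i \le i$; stating the
  condition through the action makes it stable under composition.
\<close>

definition nonraising :: "diffop \<Rightarrow> bool" where
  "nonraising D \<longleftrightarrow> (\<forall>p. degree (op_act p D) \<le> degree p)"

lemma nonraising_comp: "nonraising D \<Longrightarrow> nonraising E \<Longrightarrow> nonraising (op_comp D E)"
  unfolding nonraising_def op_act_comp by (meson le_trans)

lemma nonraising_if_on_basis:
  assumes "\<And>n. b n \<noteq> 0 \<and> degree (b n) = n" and "\<And>n. degree (op_act (b n) D) \<le> n"
  shows "nonraising D"
proof -
  have "degree (op_act p D) \<le> degree p" for p
  proof -
    have "\<forall>k\<ge>Suc (degree p). coeff (op_act p D) k = 0"
    proof (rule poly_graded_induct[where m = "Suc (degree p)" and b = b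
          and Q = "\<lambda>q. \<forall>k\<ge>Suc (degree p). coeff (op_act q D) k = 0"])
      fix n assume "n < Suc (degree p)"
      hence "degree (op_act (b n) D) \<le> degree p"
        using assms(2)[of n] by linarith
      thus "\<forall>k\<ge>Suc (degree p). coeff (op_act (b n) D) k = 0"
        by (simp add: coeff_eq_0)
    qed (simp_all add: op_act_add_left op_act_smult_left assms(1) coeff_eq_0)
    thus ?thesis
      by (intro degree_le) auto
  qed
  thus ?thesis
    by (simp add: nonraising_def)
qed

section \<open>Eigenvalue polynomials\<close>

lemma eigval_le:
  assumes "degree D \<le> n"
  shows "eigval D = (\<Sum>i\<le>n. smult (coeff (coeff D i) i) (falling_poly i))"
  unfolding eigval_def using assms
  by (intro sum.mono_neutral_left) (auto simp: coeff_eq_0)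

lemma eigval_zero [simp]: "eigval 0 = 0"
  by (simp add: eigval_def)

lemma eigval_one [simp]: "eigval 1 = 1"
  by (simp add: eigval_def falling_poly_def)

lemma eigval_order1: "eigval [:F, G:] = [:coeff F 0, coeff G 1:]"
  by (subst eigval_le[where n = 1]) (auto simp: falling_poly_def)

lemma eigval_order2:
  "eigval [:F, G, H:] = [:coeff F 0, coeff G 1 - coeff H 2, coeff H 2:]"
  by (subst eigval_le[where n = 2]) (auto simp: falling_poly_def numeral_2_eq_2)

lemma eigval_add: "eigval (D + E) = eigval D + eigval E"
proof -
  define n where "n = max (degree D) (degree E)"
  have "degree D \<le> n" "degree E \<le> n" "degree (D + E) \<le> n"
    using degree_add_le_max[of D E] by (auto simp: n_def)
  thus ?thesis
    by (simp add: eigval_le[of _ n] sum.distrib[symmetric] smult_add_left)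
qed

lemma higher_pderiv_monom_falling:
  "(pderiv ^^ i) (monom 1 n :: complex poly) = monom (poly (falling_poly i) (of_nat n)) (n - i)"
proof (induction i)
  case (Suc i)
  have "of_nat (n - i) * poly (falling_poly i) (of_nat n) =
        (of_nat n - of_nat i) * poly (falling_poly i) (of_nat n :: complex)"
  proof (cases "i \<le> n")
    case False
    hence "poly (falling_poly i) (of_nat n :: complex) = 0"
      unfolding falling_poly_def poly_prod by (intro prod_zero) auto
    thus ?thesis by simp
  qed (simp add: of_nat_diff algebra_simps)
  also have "\<dots> = poly (falling_poly (Suc i)) (of_nat n)"
    by (simp add: falling_poly_def algebra_simps)
  finally show ?case
    by (simp add: Suc.IH pderiv_monom del: of_nat_diff)
qed (simp add: falling_poly_def)

text \<open>
  Since $x^n \cdot \partial^i F_i = [n]_i\, x^{n-i} F_i$, only the term $x^i F^i_i$ of $F_i$ contributes to the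
  coefficient of $x^n$.
\<close>

lemma poly_eigval: "poly (eigval D) (of_nat n) = coeff (op_act (monom 1 n) D) n"
proof -
  have "coeff ((pderiv ^^ i) (monom 1 n) * coeff D i) n =
        poly (falling_poly i) (of_nat n) * coeff (coeff D i) i" for i
  proof (cases "i \<le> n")
    case False
    hence "poly (falling_poly i) (of_nat n :: complex) = 0"
      unfolding falling_poly_def poly_prod by (intro prod_zero) auto
    thus ?thesis by (simp add: higher_pderiv_monom_falling)
  qed (simp add: higher_pderiv_monom_falling coeff_monom_mult)
  thus ?thesis
    unfolding op_act_def eigval_def by (simp add: poly_sum coeff_sum mult.commute)
qed

lemma coeff_op_act:
  assumes "nonraising D" "degree p \<le> n"
  shows "coeff (op_act p D) n = poly (eigval D) (of_nat n) * coeff p n"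
proof -
  define r where "r = p - monom (coeff p n) n"
  have r: "degree r < n \<or> r = 0"
  proof -
    have "coeff r n = 0" "degree r \<le> n"
      using assms by (auto simp: r_def intro!: degree_diff_le degree_monom_le)
    thus ?thesis
      by (metis le_neq_implies_less leading_coeff_0_iff)
  qed
  have "coeff (op_act r D) n = 0"
    using r
  proof
    assume "degree r < n"
    thus ?thesis
      using assms(1) unfolding nonraising_def by (intro coeff_eq_0) (meson le_less_trans)
  qed simp
  moreover have "p = smult (coeff p n) (monom 1 n) + r"
    by (simp add: r_def smult_monom)
  hence "op_act p D = smult (coeff p n) (op_act (monom 1 n) D) + op_act r D"
    by (metis op_act_add_left op_act_smult_left)
  ultimately show ?thesis
    by (simp add: poly_eigval)
qed

lemma poly_eqI_nat:
  fixes p q :: "complex poly"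
  assumes "\<And>n. poly p (of_nat n) = poly q (of_nat n)"
  shows "p = q"
proof (rule ccontr)
  assume "p \<noteq> q"
  hence "finite {x. poly (p - q) x = 0}"
    by (intro poly_roots_finite) auto
  moreover have "range (of_nat :: nat \<Rightarrow> complex) \<subseteq> {x. poly (p - q) x = 0}"
    using assms by auto
  ultimately have "finite (range (of_nat :: nat \<Rightarrow> complex))"
    by (rule finite_subset[rotated])
  thus False
    by (simp add: finite_image_iff inj_of_nat)
qed

text \<open>
  This is where $\deg F_i \le i$ matters: the leading coefficient of $p \cdot D$ then depends on that of $p$
  only.
\<close>

lemma eigval_comp:
  assumes "nonraising D" "nonraising E"
  shows "eigval (op_comp D E) = eigval D * eigval E"
proof (rule poly_eqI_nat)
  fix n
  have "degree (op_act (monom 1 n) D) \<le> n"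
    using assms(1) unfolding nonraising_def by (metis degree_monom_eq one_neq_zero)
  from coeff_op_act[OF assms(2) this]
  show "poly (eigval (op_comp D E)) (of_nat n) = poly (eigval D * eigval E) (of_nat n)"
    by (simp add: poly_eigval op_act_comp mult.commute)
qed

section \<open>Monic eigenpolynomials\<close>

lemma eigenpoly_degree:
  assumes "nonraising D" "inj (\<lambda>n. poly (eigval D) (of_nat n))"
    and "op_act p D = smult (poly (eigval D) (of_nat n)) p" "p \<noteq> 0"
  shows "degree p = n"
proof -
  have "poly (eigval D) (of_nat (degree p)) * lead_coeff p = poly (eigval D) (of_nat n) * lead_coeff p"
    using coeff_op_act[OF assms(1) order_refl, of p] by (metis assms(3) coeff_smult)
  thus ?thesis
    using assms(2,4) by (auto dest: injD)
qed

lemma eigenpoly_eqI: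
  assumes "nonraising D" "inj (\<lambda>n. poly (eigval D) (of_nat n))"
    and "op_act p D = smult (poly (eigval D) (of_nat n)) p" "coeff p n = 1"
    and "op_act q D = smult (poly (eigval D) (of_nat n)) q"
  shows "q = smult (coeff q n) p"
proof (rule ccontr)
  assume neq: "q \<noteq> smult (coeff q n) p"
  define r where "r = q - smult (coeff q n) p"
  have "op_act r D = smult (poly (eigval D) (of_nat n)) r"
    by (simp add: r_def op_act_diff_left op_act_smult_left assms smult_diff_right mult.commute)
  moreover have "r \<noteq> 0" using neq by (simp add: r_def)
  ultimately have "degree r = n"
    using eigenpoly_degree[OF assms(1,2)] by blast
  moreover have "coeff r n = 0"
    by (simp add: r_def assms)
  ultimately show False
    using \<open>r \<noteq> 0\<close> by auto
qed

text \<open>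
  An operator that does not raise degrees is triangular in the monomial basis, with the values of its
  eigenvalue polynomial on the diagonal. Subtracting the $n$-th of them leaves an invertible map on the
  polynomials of degree below $n$.
\<close>

lemma resolvent_exists:
  assumes "nonraising D" "inj (\<lambda>n. poly (eigval D) (of_nat n))"
  shows "m \<le> n \<Longrightarrow> (\<forall>k\<ge>m. coeff q k = 0) \<Longrightarrow>
    \<exists>r. (\<forall>k\<ge>m. coeff r k = 0) \<and> op_act r D - smult (poly (eigval D) (of_nat n)) r = q"
proof (induction m arbitrary: q)
  case 0
  thus ?case by (intro exI[of _ 0]) (auto simp: poly_eq_iff)
next
  case (Suc m)
  let ?ev = "\<lambda>n. poly (eigval D) (of_nat n)"
  have neq: "?ev m \<noteq> ?ev n"
    using assms(2) Suc.prems(1) by (auto dest: injD)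
  \<comment> \<open>The monomial whose image cancels the top coefficient of $q$.\<close>
  define b where "b = monom (coeff q m / (?ev m - ?ev n)) m"
  have b: "degree b \<le> m"
    by (simp add: b_def degree_monom_le)
  hence b': "degree (op_act b D) \<le> m"
    using assms(1) unfolding nonraising_def by (meson le_trans)
  define q' where "q' = q - (op_act b D - smult (?ev n) b)"
  have "coeff q' k = 0" if "k \<ge> m" for k
  proof (cases "k = m")
    case True
    thus ?thesis
      using neq coeff_op_act[OF assms(1) b] by (simp add: q'_def b_def field_simps)
  next
    case False
    thus ?thesis
      using that Suc.prems(2) b b' by (simp add: q'_def coeff_eq_0)
  qed
  then obtain r where r: "\<forall>k\<ge>m. coeff r k = 0" "op_act r D - smult (?ev n) r = q'"
    using Suc.IH Suc.prems(1) by force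
  show ?case
  proof (intro exI[of _ "r + b"] conjI allI impI)
    show "coeff (r + b) k = 0" if "k \<ge> Suc m" for k
      using that r(1) b by (simp add: coeff_eq_0)
    show "op_act (r + b) D - smult (?ev n) (r + b) = q"
      using r(2) by (simp add: op_act_add_left q'_def smult_add_right algebra_simps)
  qed
qed

text \<open>
  Correct $x^n$ by the preimage, under the resolvent, of the lower-order terms that it produces.
\<close>

lemma eigenpoly_exists:
  assumes "nonraising D" "inj (\<lambda>n. poly (eigval D) (of_nat n))"
  shows "\<exists>p. degree p = n \<and> coeff p n = 1 \<and>
             op_act p D = smult (poly (eigval D) (of_nat n)) p"
proof -
  let ?ev = "poly (eigval D) (of_nat n)"
  let ?x = "monom 1 n :: complex poly"
  have "degree (op_act ?x D) \<le> n"
    using assms(1) unfolding nonraising_def by (metis degree_monom_eq one_neq_zero)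
  hence "\<forall>k\<ge>n. coeff (smult ?ev ?x - op_act ?x D) k = 0"
    using coeff_op_act[OF assms(1), of ?x n]
    by (auto simp: coeff_eq_0 degree_monom_eq le_less)
  from resolvent_exists[OF assms order_refl this] obtain r where
    r: "\<forall>k\<ge>n. coeff r k = 0" "op_act r D - smult ?ev r = smult ?ev ?x - op_act ?x D"
    by blast
  show ?thesis
  proof (intro exI[of _ "?x + r"] conjI)
    show c: "coeff (?x + r) n = 1" using r(1) by simp
    have "degree (?x + r) \<le> n"
      using r(1) by (intro degree_le) auto
    thus "degree (?x + r) = n"
      using c by (metis le_degree order_antisym zero_neq_one)
    show "op_act (?x + r) D = smult ?ev (?x + r)"
      using r(2) by (simp add: op_act_add_left smult_add_right algebra_simps)
  qed
qed

section \<open>Moments and the Pearson equation\<close>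

lemma borel_measurable_weight [measurable]: "weight v \<in> borel_measurable borel"
proof (cases v)
  case (Hermite b)
  have "weight v = (\<lambda>x. exp (- (x\<^sup>2) + 2 * b * x))"
    by (auto simp: Hermite)
  thus ?thesis by simp
next
  case (Laguerre a)
  have "weight v = (\<lambda>x. if 0 < x then exp (- x) * x powr a else 0)"
    by (auto simp: Laguerre)
  thus ?thesis by simp
next
  case (Jacobi a b)
  have "weight v = (\<lambda>x. if -1 < x \<and> x < 1 then (1 - x) powr a * (1 + x) powr b else 0)"
    by (auto simp: Jacobi)
  thus ?thesis by simp
qed

lemma weight_nonneg: "weight v x \<ge> 0"
  by (cases v) auto

lemma weight_pos: "0 < x \<Longrightarrow> x < 1 \<Longrightarrow> weight v x > 0"
  by (cases v) auto

text \<open>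
  Up to a constant the weight is the normal density with mean $b$ and variance $1/2$, whose central
  moments are finite.
\<close>

lemma integrable_power_hermite: "integrable lborel (\<lambda>x. x ^ k * weight (Hermite b) x)"
proof -
  have "integrable lborel (\<lambda>x. (\<Sum>i\<le>k. (of_nat (k choose i) * b ^ (k - i)) *
          (normal_density b (1 / sqrt 2) x * (x - b) ^ i)) * (exp (b\<^sup>2) * sqrt pi))"
    by (intro integrable_mult_left Bochner_Integration.integrable_sum integrable_mult_right integrable_normal_moment) auto
  also have "(\<lambda>x. (\<Sum>i\<le>k. (of_nat (k choose i) * b ^ (k - i)) *
          (normal_density b (1 / sqrt 2) x * (x - b) ^ i)) * (exp (b\<^sup>2) * sqrt pi)) =
        (\<lambda>x. x ^ k * weight (Hermite b) x)"
  proof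
    fix x :: real
    have "x ^ k = ((x - b) + b) ^ k" by simp
    also have "\<dots> = (\<Sum>i\<le>k. of_nat (k choose i) * (x - b) ^ i * b ^ (k - i))"
      by (rule binomial_ring)
    finally have 1: "x ^ k = (\<Sum>i\<le>k. of_nat (k choose i) * (x - b) ^ i * b ^ (k - i))" .
    have "normal_density b (1 / sqrt 2) x * (exp (b\<^sup>2) * sqrt pi) = exp (- ((x - b)\<^sup>2)) * exp (b\<^sup>2)"
      by (simp add: normal_density_def power_divide)
    also have "\<dots> = weight (Hermite b) x"
      by (simp add: exp_add[symmetric] power2_eq_square algebra_simps)
    finally have 2: "weight (Hermite b) x = normal_density b (1 / sqrt 2) x * (exp (b\<^sup>2) * sqrt pi)" ..
    show "(\<Sum>i\<le>k. (of_nat (k choose i) * b ^ (k - i)) *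
          (normal_density b (1 / sqrt 2) x * (x - b) ^ i)) * (exp (b\<^sup>2) * sqrt pi) =
        x ^ k * weight (Hermite b) x"
      unfolding 1 2 by (simp add: sum_distrib_right sum_distrib_left mult_ac)
  qed
  finally show ?thesis .
qed

lemma integrable_power_laguerre:
  assumes "\<alpha> > -1"
  shows "integrable lborel (\<lambda>x. x ^ k * weight (Laguerre \<alpha>) x)"
proof -
  define f where "f = (\<lambda>t::real. t powr (\<alpha> + k + 1 - 1) / exp t)"
  have "(f has_integral Gamma (\<alpha> + k + 1)) {0..}"
    unfolding f_def by (rule Gamma_integral_real) (use assms in auto)
  hence "f absolutely_integrable_on {0..}"
    by (intro nonnegative_absolutely_integrable_1) (auto simp: f_def has_integral_integrable)
  hence "integrable lebesgue (\<lambda>x. indicator {0..} x *\<^sub>R f x)"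
    by (simp add: set_integrable_def)
  hence "integrable lborel (\<lambda>x. indicator {0..} x *\<^sub>R f x)"
    by (subst (asm) integrable_completion) (auto simp: f_def)
  also have "(\<lambda>x. indicator {0..} x *\<^sub>R f x) = (\<lambda>x. x ^ k * weight (Laguerre \<alpha>) x)"
    by (rule ext)
       (auto simp: f_def indicator_def powr_add powr_realpow exp_minus field_simps split: if_splits)
  finally show ?thesis .
qed

text \<open>
  The weight itself is a Beta integrand after the substitution $t = (1 + x)/2$, and $|x^k| \le 1$ on its
  support.
\<close>

lemma integrable_power_jacobi:
  assumes "\<alpha> > -1" "\<beta> > -1"
  shows "integrable lborel (\<lambda>x. x ^ k * weight (Jacobi \<alpha> \<beta>) x)"
proof -
  define f where "f = (\<lambda>t::real. indicator {0..1} t *\<^sub>R (t powr (\<beta> + 1 - 1) * (1 - t) powr (\<alpha> + 1 - 1)))"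
  have "integrable lborel f"
    using integrable_Beta[of "\<beta> + 1" "\<alpha> + 1"] assms unfolding set_integrable_def f_def by simp
  hence "integrable lborel (\<lambda>x. f (1 / 2 + 1 / 2 * x) * 2 powr (\<alpha> + \<beta>))"
    by (intro integrable_mult_left lborel_integrable_real_affine) auto
  also have "(\<lambda>x. f (1 / 2 + 1 / 2 * x) * 2 powr (\<alpha> + \<beta>)) = weight (Jacobi \<alpha> \<beta>)"
  proof
    fix x :: real
    show "f (1 / 2 + 1 / 2 * x) * 2 powr (\<alpha> + \<beta>) = weight (Jacobi \<alpha> \<beta>) x"
    proof (cases "-1 < x \<and> x < 1")
      case True
      have "1 / 2 + 1 / 2 * x = (1 + x) / 2" "1 - (1 + x) / 2 = (1 - x) / 2"
        by (simp_all add: field_simps)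
      thus ?thesis
        using True by (simp add: f_def powr_divide powr_add field_simps)
    next
      case False
      hence "f (1 / 2 + 1 / 2 * x) = 0"
        by (cases "x = 1 \<or> x = -1") (auto simp: f_def indicator_def)
      thus ?thesis using False by auto
    qed
  qed
  finally have int: "integrable lborel (weight (Jacobi \<alpha> \<beta>))" .
  show ?thesis
  proof (rule Bochner_Integration.integrable_bound[OF int])
    show "AE x in lborel. norm (x ^ k * weight (Jacobi \<alpha> \<beta>) x) \<le> norm (weight (Jacobi \<alpha> \<beta>) x)"
      by (intro AE_I2)
         (auto simp: abs_mult power_abs intro!: mult_left_le_one_le power_le_one)
  qed simp
qed

lemma integrable_power_weight:
  "admissible v \<Longrightarrow> integrable lborel (\<lambda>x. x ^ k * weight v x)"
  by (cases v) (simp_all only: admissible.simps integrable_power_hermite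
      integrable_power_laguerre integrable_power_jacobi)

lemma integrable_poly:
  fixes w :: "real \<Rightarrow> real" and p :: "complex poly"
  assumes "\<And>k. integrable lborel (\<lambda>x. x ^ k * w x)"
  shows "integrable lborel (\<lambda>x. poly p (of_real x) * of_real (w x))"
proof -
  have "integrable lborel (\<lambda>x. \<Sum>i\<le>degree p. coeff p i * complex_of_real (x ^ i * w x))"
    by (intro Bochner_Integration.integrable_sum integrable_mult_right integrable_of_real assms)
  thus ?thesis
    by (simp add: poly_altdef sum_distrib_right sum_distrib_left mult_ac)
qed

text \<open>
  If $(\phi w)' = \psi w$ inside the interval, then $(p'\phi + p\psi) w$ is the derivative of $p \phi w$,
  which vanishes at both ends. Here \<open>g\<close> is a version of $\phi w$ that need not agree with it outside the
  interval, which allows it to be given by a single formula.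
\<close>

lemma pearson_FTC:
  fixes l r :: ereal and w g \<phi> \<psi> :: "real \<Rightarrow> real" and p \<Phi> \<Psi> :: "complex poly"
  assumes "l < r"
    and supp: "\<And>x. \<not> (l < ereal x \<and> ereal x < r) \<Longrightarrow> w x = 0"
    and int: "\<And>k. integrable lborel (\<lambda>x. x ^ k * w x)"
    and cont: "\<And>x. l < ereal x \<Longrightarrow> ereal x < r \<Longrightarrow> isCont w x"
    and g: "\<And>x. l < ereal x \<Longrightarrow> ereal x < r \<Longrightarrow> g x = \<phi> x * w x"
    and g': "\<And>x. l < ereal x \<Longrightarrow> ereal x < r \<Longrightarrow> (g has_real_derivative \<psi> x * w x) (at x)"
    and lim_l: "\<And>k. (((\<lambda>x. x ^ k * g x) \<circ> real_of_ereal) \<longlongrightarrow> 0) (at_right l)"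
    and lim_r: "\<And>k. (((\<lambda>x. x ^ k * g x) \<circ> real_of_ereal) \<longlongrightarrow> 0) (at_left r)"
    and \<Phi>: "\<And>x. poly \<Phi> (of_real x) = of_real (\<phi> x)"
    and \<Psi>: "\<And>x. poly \<Psi> (of_real x) = of_real (\<psi> x)"
  shows "(LINT x|lborel. poly (pderiv p * \<Phi> + p * \<Psi>) (of_real x) * of_real (w x)) = 0"
proof -
  define f where "f = (\<lambda>x::real. poly (pderiv p * \<Phi> + p * \<Psi>) (of_real x) * of_real (w x))"
  define F where "F = (\<lambda>x::real. poly p (of_real x) * of_real (g x))"
  have lim: "((F \<circ> real_of_ereal) \<longlongrightarrow> 0) X"
    if "\<And>k. (((\<lambda>x. x ^ k * g x) \<circ> real_of_ereal) \<longlongrightarrow> 0) X" for X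
  proof -
    have "((\<lambda>x. \<Sum>i\<le>degree p. coeff p i *
            of_real (((\<lambda>x. x ^ i * g x) \<circ> real_of_ereal) x)) \<longlongrightarrow>
          (\<Sum>i\<le>degree p. coeff p i * of_real 0)) X"
      by (intro tendsto_sum tendsto_mult tendsto_const tendsto_of_real that)
    thus ?thesis
      by (simp add: F_def poly_altdef sum_distrib_right sum_distrib_left o_def mult_ac)
  qed
  have "integrable lborel f"
    unfolding f_def by (rule integrable_poly[OF int])
  moreover have f_ind: "indicator (einterval l r) x *\<^sub>R f x = f x" for x
    using supp[of x] by (auto simp: f_def indicator_def einterval_def)
  ultimately have "set_integrable lborel (einterval l r) f"
    by (simp add: set_integrable_def)
  hence "(LBINT x=l..r. f x) = 0 - 0"
  proof (rule interval_integral_FTC_integrable[OF \<open>l < r\<close>, of F, rotated 2])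
    show "((F \<circ> real_of_ereal) \<longlongrightarrow> 0) (at_right l)" "((F \<circ> real_of_ereal) \<longlongrightarrow> 0) (at_left r)"
      by (intro lim lim_l lim_r)+
  next
    fix x assume x: "l < ereal x" "ereal x < r"
    show "isCont f x"
      unfolding f_def by (intro continuous_intros isCont_o2[OF _ poly_isCont] cont[OF x])
    have "(F has_vector_derivative poly p (of_real x) * of_real (\<psi> x * w x) +
            poly (pderiv p) (of_real x) * of_real (g x)) (at x)"
      unfolding F_def
      by (intro has_vector_derivative_mult has_vector_derivative_of_real
            has_vector_derivative_real_field poly_DERIV)
         (use g'[OF x] in \<open>simp add: has_real_derivative_iff_has_vector_derivative\<close>)
    thus "(F has_vector_derivative f x) (at x)"
      by (simp add: f_def g[OF x] \<Phi> \<Psi> algebra_simps)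
  qed
  moreover have "(LBINT x=l..r. f x) = (LINT x|lborel. f x)"
    unfolding interval_lebesgue_integral_def set_lebesgue_integral_def f_ind
    using \<open>l < r\<close> by simp
  ultimately show ?thesis
    by (simp add: f_def)
qed

lemma pearson_hermite:
  fixes p :: "complex poly"
  shows "(LINT x|lborel. poly (pderiv p * 1 + p * [:2 * of_real b, -2:]) (of_real x) *
      of_real (weight (Hermite b) x)) = 0"
proof (rule pearson_FTC[where l = "-\<infinity>" and r = \<infinity> and g = "weight (Hermite b)"
        and \<phi> = "\<lambda>_. 1" and \<psi> = "\<lambda>x. 2 * b - 2 * x"])
  have eq: "weight (Hermite b) = (\<lambda>x. exp (- (x\<^sup>2) + 2 * b * x))"
    by auto
  show "(((\<lambda>x. x ^ k * weight (Hermite b) x) \<circ> real_of_ereal) \<longlongrightarrow> 0) (at_right (- \<infinity>))" for k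
    unfolding ereal_tendsto_simps eq by real_asymp
  show "(((\<lambda>x. x ^ k * weight (Hermite b) x) \<circ> real_of_ereal) \<longlongrightarrow> 0) (at_left \<infinity>)" for k
    unfolding ereal_tendsto_simps eq by real_asymp
  show "isCont (weight (Hermite b)) x" for x
    unfolding eq by (intro continuous_intros)
  show "(weight (Hermite b) has_real_derivative (2 * b - 2 * x) * weight (Hermite b) x) (at x)" for x
    unfolding eq by (auto intro!: derivative_eq_intros simp: algebra_simps)
qed (use integrable_power_hermite in auto)

lemma pearson_laguerre:
  fixes p :: "complex poly"
  assumes "\<alpha> > -1"
  shows "(LINT x|lborel. poly (pderiv p * [:0, 1:] + p * [:of_real \<alpha> + 1, -1:]) (of_real x) *
      of_real (weight (Laguerre \<alpha>) x)) = 0"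
proof (rule pearson_FTC[where l = 0 and r = \<infinity> and g = "\<lambda>x. exp (-x) * x powr (\<alpha> + 1)"
        and \<phi> = "\<lambda>x. x" and \<psi> = "\<lambda>x. \<alpha> + 1 - x"])
  show "(((\<lambda>x. x ^ k * (exp (-x) * x powr (\<alpha> + 1))) \<circ> real_of_ereal) \<longlongrightarrow> 0) (at_right 0)" for k
    unfolding zero_ereal_def ereal_tendsto_simps using assms by real_asymp
  show "(((\<lambda>x. x ^ k * (exp (-x) * x powr (\<alpha> + 1))) \<circ> real_of_ereal) \<longlongrightarrow> 0) (at_left \<infinity>)" for k
    unfolding ereal_tendsto_simps by real_asymp
  show "exp (-x) * x powr (\<alpha> + 1) = x * weight (Laguerre \<alpha>) x" if "0 < ereal x" for x
    using that by (simp add: powr_add)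
  show "((\<lambda>x. exp (-x) * x powr (\<alpha> + 1)) has_real_derivative
          (\<alpha> + 1 - x) * weight (Laguerre \<alpha>) x) (at x)" if "0 < ereal x" for x
  proof -
    have x: "x > 0" using that by simp
    have "((\<lambda>x. exp (-x)) has_real_derivative - exp (-x)) (at x)"
      by (auto intro!: derivative_eq_intros)
    from DERIV_mult[OF this has_real_derivative_powr[OF x, of "\<alpha> + 1"]] show ?thesis
      by (rule DERIV_cong) (use x in \<open>simp add: powr_add algebra_simps\<close>)
  qed
  show "isCont (weight (Laguerre \<alpha>)) x" if "0 < ereal x" for x
  proof -
    have "isCont (\<lambda>x. exp (-x) * x powr \<alpha>) x"
      using that by (intro continuous_intros) auto
    moreover have "eventually (\<lambda>y. weight (Laguerre \<alpha>) y = exp (-y) * y powr \<alpha>) (nhds x)"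
      using eventually_nhds_in_open[of "{0<..}" x] that by (auto elim!: eventually_mono)
    ultimately show ?thesis
      using isCont_cong by fast
  qed
  show "weight (Laguerre \<alpha>) x = 0" if "\<not> (0 < ereal x \<and> ereal x < \<infinity>)" for x
    using that by auto
qed (use integrable_power_laguerre[OF assms] in \<open>auto simp: \<open>\<alpha> > -1\<close>\<close>)

lemma pearson_jacobi:
  fixes p :: "complex poly"
  assumes "\<alpha> > -1" "\<beta> > -1"
  shows "(LINT x|lborel. poly (pderiv p * [:1, 0, -1:] +
        p * [:of_real \<beta> - of_real \<alpha>, - (of_real \<alpha> + of_real \<beta> + 2):]) (of_real x) *
      of_real (weight (Jacobi \<alpha> \<beta>) x)) = 0"
proof (rule pearson_FTC[where l = "ereal (-1)" and r = "ereal 1"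
        and g = "\<lambda>x. (1 - x) powr (\<alpha> + 1) * (1 + x) powr (\<beta> + 1)"
        and \<phi> = "\<lambda>x. 1 - x\<^sup>2" and \<psi> = "\<lambda>x. \<beta> - \<alpha> - x * (\<alpha> + \<beta> + 2)"])
  let ?g = "\<lambda>x. (1 - x) powr (\<alpha> + 1) * (1 + x) powr (\<beta> + 1)"
  have "((\<lambda>x. x ^ k * ?g x) \<longlongrightarrow> (-1) ^ k * ((1 - (-1)) powr (\<alpha> + 1) * (1 + (-1)) powr (\<beta> + 1)))
          (at_right (-1))" for k
    using assms by (intro tendsto_intros tendsto_powr') (auto simp: eventually_at_filter)
  thus "(((\<lambda>x. x ^ k * ?g x) \<circ> real_of_ereal) \<longlongrightarrow> 0) (at_right (ereal (-1)))" for k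
    unfolding ereal_tendsto_simps by simp
  have "((\<lambda>x. x ^ k * ?g x) \<longlongrightarrow> 1 ^ k * ((1 - 1) powr (\<alpha> + 1) * (1 + 1) powr (\<beta> + 1)))
          (at_left 1)" for k
    using assms by (intro tendsto_intros tendsto_powr') (auto simp: eventually_at_filter)
  thus "(((\<lambda>x. x ^ k * ?g x) \<circ> real_of_ereal) \<longlongrightarrow> 0) (at_left (ereal 1))" for k
    unfolding ereal_tendsto_simps by simp
  show "?g x = (1 - x\<^sup>2) * weight (Jacobi \<alpha> \<beta>) x" if "ereal (-1) < ereal x" "ereal x < ereal 1" for x
    using that by (simp add: powr_add power2_eq_square algebra_simps)
  show "(?g has_real_derivative (\<beta> - \<alpha> - x * (\<alpha> + \<beta> + 2)) * weight (Jacobi \<alpha> \<beta>) x) (at x)"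
    if "ereal (-1) < ereal x" "ereal x < ereal 1" for x
  proof -
    have x: "1 - x > 0" "1 + x > 0" using that by auto
    have "((\<lambda>x. (1 - x) powr (\<alpha> + 1)) has_real_derivative
            (\<alpha> + 1) * (1 - x) powr (\<alpha> + 1 - 1) * (-1)) (at x)"
      by (rule DERIV_chain2[where g = "\<lambda>x. 1 - x", OF has_real_derivative_powr[OF x(1)]])
         (auto intro!: derivative_eq_intros)
    moreover have "((\<lambda>x. (1 + x) powr (\<beta> + 1)) has_real_derivative
            (\<beta> + 1) * (1 + x) powr (\<beta> + 1 - 1) * 1) (at x)"
      by (rule DERIV_chain2[where g = "\<lambda>x. 1 + x", OF has_real_derivative_powr[OF x(2)]])
         (auto intro!: derivative_eq_intros)
    ultimately have "(?g has_real_derivative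
        (\<alpha> + 1) * (1 - x) powr (\<alpha> + 1 - 1) * (-1) * (1 + x) powr (\<beta> + 1) +
        (\<beta> + 1) * (1 + x) powr (\<beta> + 1 - 1) * 1 * (1 - x) powr (\<alpha> + 1)) (at x)"
      by (rule DERIV_mult)
    thus ?thesis
      by (rule DERIV_cong) (use x in \<open>simp add: powr_add algebra_simps\<close>)
  qed
  show "isCont (weight (Jacobi \<alpha> \<beta>)) x" if "ereal (-1) < ereal x" "ereal x < ereal 1" for x
  proof -
    have "isCont (\<lambda>x. (1 - x) powr \<alpha> * (1 + x) powr \<beta>) x"
      using that by (intro continuous_intros) auto
    moreover have "eventually (\<lambda>y. weight (Jacobi \<alpha> \<beta>) y = (1 - y) powr \<alpha> * (1 + y) powr \<beta>) (nhds x)"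
      using eventually_nhds_in_open[of "{-1<..<1}" x] that by (auto elim!: eventually_mono)
    ultimately show ?thesis
      using isCont_cong by fast
  qed
  show "weight (Jacobi \<alpha> \<beta>) x = 0" if "\<not> (ereal (-1) < ereal x \<and> ereal x < ereal 1)" for x
    using that by auto
qed (use integrable_power_jacobi[OF assms] in \<open>auto simp: power2_eq_square algebra_simps\<close>)

lemma coeff_order2: "coeff [:f, g, h:] 1 = g" "coeff [:f, g, h:] 2 = h"
  by (simp_all add: numeral_2_eq_2)

lemma pearson:
  assumes "admissible v"
  shows "(LINT x|lborel. poly (pderiv p * coeff (delta v) 2 + p * coeff (delta v) 1) (of_real x) *
        of_real (weight v x)) = 0"
proof (cases v)
  case (Hermite b)
  show ?thesis
    using pearson_hermite[of p b] unfolding Hermite by (simp only: delta.simps coeff_order2)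
next
  case (Laguerre a)
  show ?thesis
    using pearson_laguerre[of a p] assms unfolding Laguerre
    by (simp only: delta.simps coeff_order2 admissible.simps)
next
  case (Jacobi a b)
  show ?thesis
    using pearson_jacobi[of a b p] assms unfolding Jacobi
    by (simp only: delta.simps coeff_order2 admissible.simps)
qed

text \<open>
  A vanishing integral forces $|p|^2 w = 0$ almost everywhere, but all the weights are positive on $(0,1)$ and a
  nonzero polynomial has finitely many roots.
\<close>

lemma weight_positive_definite:
  assumes "admissible v"
    and "(LINT x|lborel. poly p (of_real x) * of_real (weight v x) * cnj (poly p (of_real x))) = 0"
  shows "p = 0"
proof (rule ccontr)
  assume "p \<noteq> 0"
  define h where "h = (\<lambda>x. (cmod (poly p (of_real x)))\<^sup>2 * weight v x)"
  have h: "poly p (of_real x) * of_real (weight v x) * cnj (poly p (of_real x)) = of_real (h x)" for x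
    unfolding h_def of_real_mult complex_norm_square by (simp only: mult_ac)
  \<comment> \<open>On the real line $q$ is $|p|^2$, which transfers integrability from polynomials to the integrand.\<close>
  define q where "q = p * map_poly cnj p"
  have q: "poly q (of_real x) = poly p (of_real x) * cnj (poly p (of_real x))" for x :: real
    by (simp only: q_def poly_mult poly_cnj complex_cnj_complex_of_real)
  have "integrable lborel (\<lambda>x. poly q (of_real x) * complex_of_real (weight v x))"
    by (rule integrable_poly[OF integrable_power_weight[OF assms(1)]])
  also have "(\<lambda>x. poly q (of_real x) * complex_of_real (weight v x)) = (\<lambda>x. complex_of_real (h x))"
    unfolding q h[symmetric] by (rule ext) (simp only: mult_ac)
  finally have int: "integrable lborel h"
    using integrable_Re by fastforce
  have "(LINT x|lborel. h x) = 0"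
    using assms(2) unfolding h integral_complex_of_real by simp
  hence "AE x in lborel. h x = 0"
    using int by (subst (asm) integral_nonneg_eq_0_iff_AE)
      (auto simp: h_def weight_nonneg)
  moreover have "AE x in lborel. x \<notin> {x. poly p (complex_of_real x) = 0}"
  proof (rule AE_not_in)
    have "finite (complex_of_real -` {z. poly p z = 0})"
      using \<open>p \<noteq> 0\<close> by (intro finite_vimageI poly_roots_finite) (auto simp: inj_on_def)
    hence "finite {x. poly p (complex_of_real x) = 0}"
      by (simp add: vimage_def)
    thus "{x. poly p (complex_of_real x) = 0} \<in> null_sets lborel"
      by (rule finite_imp_null_set_lborel)
  qed
  ultimately have "AE x in lborel. x \<notin> {0<..<1::real}"
  proof eventually_elim
    case (elim x)
    hence "weight v x = 0" by (simp add: h_def)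
    thus ?case using weight_pos[of x v] by auto
  qed
  moreover have "{x. \<not> x \<notin> {0<..<1}} = {0<..<1::real}"
    by auto
  ultimately have "emeasure lborel {0<..<1::real} = 0"
    by (subst (asm) AE_iff_measurable[OF _ refl]) auto
  thus False
    using emeasure_lborel_Ioo[of 0 1] by simp
qed

section \<open>Classical orthogonal polynomials as eigenpolynomials\<close>

lemma eigval_delta:
  "eigval (delta (Hermite b)) = [:0, -2:]"
  "eigval (delta (Laguerre \<alpha>)) = [:0, -1:]"
  "eigval (delta (Jacobi \<alpha> \<beta>)) = [:0, - (of_real \<alpha> + of_real \<beta> + 1), -1:]"
  by (simp_all add: eigval_order2 coeff_order2 numeral_2_eq_2)

lemma nonraising_order2:
  assumes "degree \<Psi> \<le> 1" "degree \<Phi> \<le> 2"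
  shows "nonraising [:0, \<Psi>, \<Phi>:]"
  unfolding nonraising_def
proof
  fix p :: "complex poly"
  have "degree (pderiv p * \<Psi>) \<le> degree p"
  proof (cases "degree p = 0")
    case True
    hence "pderiv p = 0" by (simp add: pderiv_eq_0_iff)
    thus ?thesis by simp
  next
    case False
    have "degree (pderiv p * \<Psi>) \<le> degree (pderiv p) + degree \<Psi>"
      by (rule degree_mult_le)
    thus ?thesis using assms False by (simp add: degree_pderiv)
  qed
  moreover have "degree (pderiv (pderiv p) * \<Phi>) \<le> degree p"
  proof (cases "degree p \<le> 1")
    case True
    hence "pderiv (pderiv p) = 0" by (simp add: pderiv_eq_0_iff degree_pderiv)
    thus ?thesis by simp
  next
    case False
    have "degree (pderiv (pderiv p) * \<Phi>) \<le> degree (pderiv (pderiv p)) + degree \<Phi>"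
      by (rule degree_mult_le)
    thus ?thesis using assms False by (simp add: degree_pderiv)
  qed
  ultimately show "degree (op_act p [:0, \<Psi>, \<Phi>:]) \<le> degree p"
    by (simp add: op_act_order2 degree_add_le)
qed

lemma nonraising_delta: "nonraising (delta v)"
  by (cases v) (auto intro!: nonraising_order2 degree_le simp: coeff_pCons split: nat.splits)

text \<open>
  For Jacobi weights $\lambda_m - \lambda_n = -(m - n)(m + n + \alpha + \beta + 1)$, and
  $\alpha + \beta > -2$.
\<close>

lemma delta_eigenvalues_distinct:
  assumes "admissible v"
  shows "inj (\<lambda>n. poly (eigval (delta v)) (of_nat n))"
proof (cases v)
  case (Jacobi \<alpha> \<beta>)
  show ?thesis
  proof (rule injI, rule ccontr)
    fix m n :: nat
    assume eq: "poly (eigval (delta v)) (of_nat m) = poly (eigval (delta v)) (of_nat n)"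
      and "m \<noteq> n"
    have "complex_of_real ((real m - real n) * (real m + real n + \<alpha> + \<beta> + 1)) = 0"
      using eq unfolding Jacobi eigval_delta by (simp add: algebra_simps)
    hence "(real m - real n) * (real m + real n + \<alpha> + \<beta> + 1) = 0"
      unfolding of_real_eq_0_iff .
    moreover have "real m + real n \<ge> 1"
      using \<open>m \<noteq> n\<close> by linarith
    ultimately show False
      using \<open>m \<noteq> n\<close> assms Jacobi by auto
  qed
qed (auto simp: eigval_delta inj_on_def simp del: delta.simps)

definition moment :: "classical \<Rightarrow> complex poly \<Rightarrow> complex" where
  "moment v p = (LINT x|lborel. poly p (of_real x) * of_real (weight v x))"

lemma moment_add:
  "admissible v \<Longrightarrow> moment v (p + q) = moment v p + moment v q"
  unfolding moment_def
  by (simp add: distrib_right Bochner_Integration.integral_add integrable_poly integrable_power_weight)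

lemma moment_smult: "moment v (smult c p) = c * moment v p"
  by (simp add: moment_def mult.assoc)

lemma moment_diff:
  "admissible v \<Longrightarrow> moment v (p - q) = moment v p - moment v q"
  using moment_add[of v "p - q" q] by simp

text \<open>
  Apply the Pearson equation to $p'q$: the moment of $(p \cdot \delta)\, q$ is minus that of
  $p' q' \Phi$, which is symmetric in $p$ and $q$.
\<close>

lemma moment_delta_symmetric:
  assumes "admissible v"
  shows "moment v (op_act p (delta v) * q) = moment v (p * op_act q (delta v))"
proof -
  define \<Phi> \<Psi> where "\<Phi> = coeff (delta v) 2" and "\<Psi> = coeff (delta v) 1"
  have act: "op_act p (delta v) = pderiv (pderiv p) * \<Phi> + pderiv p * \<Psi>" for p
    by (cases v) (simp_all add: \<Phi>_def \<Psi>_def op_act_order2 coeff_order2)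
  have *: "moment v (op_act p (delta v) * q) = - moment v (pderiv p * pderiv q * \<Phi>)" for p q
  proof -
    have "moment v (pderiv (pderiv p * q) * \<Phi> + (pderiv p * q) * \<Psi>) = 0"
      unfolding moment_def \<Phi>_def \<Psi>_def by (rule pearson[OF assms])
    also have "pderiv (pderiv p * q) * \<Phi> + (pderiv p * q) * \<Psi> =
               op_act p (delta v) * q + pderiv p * pderiv q * \<Phi>"
      by (simp add: act pderiv_mult algebra_simps)
    finally show ?thesis
      by (simp add: moment_add assms eq_neg_iff_add_eq_0)
  qed
  show ?thesis
    using *[of p q] *[of q p] by (simp add: mult.commute)
qed

definition inner_w :: "classical \<Rightarrow> complex poly \<Rightarrow> complex poly \<Rightarrow> complex" where
  "inner_w v p q = (LINT x|lborel. poly p (of_real x) * of_real (weight v x) * cnj (poly q (of_real x)))"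

lemma inner_w_integrand:
  "poly p (of_real x) * of_real (weight v x) * cnj (poly q (of_real x)) =
   poly (p * map_poly cnj q) (of_real x) * of_real (weight v x)"
  by (simp only: poly_mult poly_cnj complex_cnj_complex_of_real mult_ac)

lemma integrable_inner_w:
  "admissible v \<Longrightarrow>
     integrable lborel (\<lambda>x. poly p (of_real x) * of_real (weight v x) * cnj (poly q (of_real x)))"
  unfolding inner_w_integrand by (intro integrable_poly integrable_power_weight)

lemma inner_w_moment: "inner_w v p q = moment v (p * map_poly cnj q)"
  unfolding inner_w_def moment_def inner_w_integrand ..

lemma inner_w_commute: "inner_w v q p = cnj (inner_w v p q)"
proof -
  have "inner_w v q p = (LINT x|lborel.
          cnj (poly p (of_real x) * of_real (weight v x) * cnj (poly q (of_real x))))"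
    unfolding inner_w_def
    by (intro Bochner_Integration.integral_cong refl) (simp add: mult_ac)
  thus ?thesis
    by (simp only: inner_w_def Bochner_Integration.integral_cnj)
qed

lemma map_poly_cnj_add: "map_poly cnj (p + q) = map_poly cnj p + map_poly cnj q"
  by (rule poly_eqI) (simp add: coeff_map_poly)

lemma map_poly_cnj_smult: "map_poly cnj (smult c p) = smult (cnj c) (map_poly cnj p)"
  by (rule poly_eqI) (simp add: coeff_map_poly)

lemma inner_w_diff_left: "admissible v \<Longrightarrow> inner_w v (p - q) r = inner_w v p r - inner_w v q r"
  by (simp add: inner_w_moment left_diff_distrib moment_diff)

lemma inner_w_smult_left: "inner_w v (smult c p) r = c * inner_w v p r"
  by (simp add: inner_w_moment moment_smult)

lemma inner_w_add_right: "admissible v \<Longrightarrow> inner_w v r (p + q) = inner_w v r p + inner_w v r q"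
  by (simp add: inner_w_moment map_poly_cnj_add distrib_left moment_add)

lemma inner_w_smult_right: "inner_w v r (smult c p) = cnj c * inner_w v r p"
  by (simp add: inner_w_moment map_poly_cnj_smult moment_smult)

lemma inner_w_zero [simp]: "inner_w v 0 p = 0" "inner_w v p 0 = 0"
  by (simp_all add: inner_w_def)

lemma monic_ops_weight:
  "monic_ops (weight v) P \<longleftrightarrow>
     (\<forall>n. degree (P n) = n \<and> lead_coeff (P n) = 1) \<and> (\<forall>m n. m \<noteq> n \<longrightarrow> inner_w v (P m) (P n) = 0)"
  by (simp add: monic_ops_def inner_w_def)

text \<open>
  Eigenpolynomials of the symmetric operator $\delta$ with different eigenvalues are orthogonal for the
  bilinear form, without complex conjugation. Hence $P_n$ annihilates every polynomial of lower degree,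
  among them the conjugates of the earlier $P_m$; the other half of the sesquilinear orthogonality
  follows by Hermitian symmetry.
\<close>

lemma monic_ops_exist:
  assumes "admissible v"
  obtains P where "monic_ops (weight v) P"
    and "\<And>n. op_act (P n) (delta v) = smult (poly (eigval (delta v)) (of_nat n)) (P n)"
proof -
  let ?ev = "\<lambda>n. poly (eigval (delta v)) (of_nat n)"
  obtain P where P: "\<And>n. degree (P n) = n \<and> coeff (P n) n = 1 \<and>
      op_act (P n) (delta v) = smult (?ev n) (P n)"
    using eigenpoly_exists[OF nonraising_delta delta_eigenvalues_distinct[OF assms]] by metis
  have deg: "P n \<noteq> 0 \<and> degree (P n) = n" for n
    using P[of n] by auto
  have 1: "moment v (P m * P n) = 0" if "m \<noteq> n" for m n
  proof -
    have "?ev m * moment v (P m * P n) = ?ev n * moment v (P m * P n)"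
      using moment_delta_symmetric[OF assms, of "P m" "P n"] P by (simp add: moment_smult)
    moreover have "?ev m \<noteq> ?ev n"
      using delta_eigenvalues_distinct[OF assms] that by (auto dest: injD)
    ultimately show ?thesis by simp
  qed
  have 2: "moment v (P n * q) = 0" if "\<forall>k\<ge>n. coeff q k = 0" for n q
  proof (rule poly_graded_induct[where m = n and b = P and Q = "\<lambda>q. moment v (P n * q) = 0"])
    show "moment v (P n * 0) = 0"
      using moment_smult[of v 0 0] by simp
  qed (use deg 1 that assms in \<open>simp_all add: distrib_left moment_add moment_smult\<close>)
  have 3: "inner_w v (P m) (P n) = 0" if "n < m" for m n
    unfolding inner_w_moment
    by (rule 2) (use that deg in \<open>simp add: coeff_map_poly coeff_eq_0\<close>)
  have "inner_w v (P m) (P n) = 0" if "m \<noteq> n" for m n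
    using that 3[of n m] 3[of m n] inner_w_commute[of v "P m" "P n"] by (cases m n rule: linorder_cases) auto
  hence "monic_ops (weight v) P"
    using P by (auto simp: monic_ops_weight)
  with P show ?thesis by (intro that) auto
qed

text \<open>
  The difference of the two sides has degree below $n$ and is orthogonal to all polynomials of degree below
  $n$, in particular to itself. The lemma yields uniqueness of the orthogonal polynomials in the scalar
  and, entry by entry, in the matrix case.
\<close>

lemma orthogonal_imp_multiple:
  assumes "admissible v" "monic_ops (weight v) P" "degree q \<le> n"
    and orth: "\<And>k. k < n \<Longrightarrow> inner_w v q (P k) = 0"
  shows "q = smult (coeff q n) (P n)"
proof -
  have P: "P k \<noteq> 0 \<and> degree (P k) = k" "coeff (P k) k = 1" for k
    using assms(2) unfolding monic_ops_weight by (metis leading_coeff_0_iff zero_neq_one)+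
  \<comment> \<open>The coefficient of $x^n$ cancels, so that $r$ lies in the span of the $P_k$ with $k < n$.\<close>
  define r where "r = q - smult (coeff q n) (P n)"
  have r: "\<forall>k\<ge>n. coeff r k = 0"
  proof (intro allI impI)
    fix k assume "k \<ge> n"
    thus "coeff r k = 0"
      using P[of n] assms(3) by (cases "k = n") (simp_all add: r_def coeff_eq_0)
  qed
  have "inner_w v r (P k) = 0" if "k < n" for k
    using orth[OF that] assms(1,2) that
    by (simp add: r_def inner_w_diff_left inner_w_smult_left monic_ops_weight)
  hence "inner_w v r r = 0"
  proof (intro poly_graded_induct[where m = n and b = P and p = r and Q = "\<lambda>s. inner_w v r s = 0"])
    show "P k \<noteq> 0 \<and> degree (P k) = k" for k
      by (rule P)
  qed (simp_all add: r inner_w_add_right inner_w_smult_right assms(1))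
  hence "r = 0"
    unfolding inner_w_def by (rule weight_positive_definite[OF assms(1)])
  thus ?thesis by (simp add: r_def)
qed

lemma monic_ops_unique:
  assumes "admissible v" "monic_ops (weight v) P" "monic_ops (weight v) Q"
  shows "P = Q"
proof
  fix n
  show "P n = Q n"
  proof (induction n rule: less_induct)
    case (less n)
    have "inner_w v (Q n) (P k) = 0" if "k < n" for k
      using assms(3) less.IH[OF that] that by (simp add: monic_ops_weight)
    moreover have "degree (Q n) = n" "coeff (Q n) n = 1"
      using assms(3) unfolding monic_ops_weight by metis+
    ultimately show "P n = Q n"
      using orthogonal_imp_multiple[OF assms(1,2), of "Q n" n] by simp
  qed
qed

lemma monic_ops_ops:
  assumes "admissible v"
  shows "monic_ops (weight v) (ops (weight v))"
proof -
  obtain P where P: "monic_ops (weight v) P"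
    using monic_ops_exist[OF assms] by blast
  show ?thesis
    unfolding ops_def using P monic_ops_unique[OF assms _ P] by (rule theI)
qed

lemma
  assumes "admissible v"
  shows degree_ops: "degree (ops (weight v) n) = n"
    and coeff_ops: "coeff (ops (weight v) n) n = 1"
    and ops_nonzero: "ops (weight v) n \<noteq> 0"
  using monic_ops_ops[OF assms] unfolding monic_ops_weight
  by (metis, metis, metis leading_coeff_0_iff zero_neq_one)

lemma op_act_ops_delta:
  assumes "admissible v"
  shows "op_act (ops (weight v) n) (delta v) =
           smult (poly (eigval (delta v)) (of_nat n)) (ops (weight v) n)"
  by (metis monic_ops_exist[OF assms] monic_ops_unique[OF assms] monic_ops_ops[OF assms])

lemma eigenpoly_ops:
  assumes "admissible v"
    and "op_act q (delta v) = smult (poly (eigval (delta v)) (of_nat n)) q"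
  shows "q = smult (coeff q n) (ops (weight v) n)"
  using assms nonraising_delta delta_eigenvalues_distinct op_act_ops_delta coeff_ops
  by (intro eigenpoly_eqI)

section \<open>Direct sums of weights\<close>

lemma integrable_matrix:
  fixes f :: "'a \<Rightarrow> complex ^ 'n ^ 'm"
  assumes "\<And>a b. integrable M (\<lambda>x. f x $ a $ b)"
  shows "integrable M f"
proof -
  define E :: "'m \<Rightarrow> 'n \<Rightarrow> complex \<Rightarrow> complex ^ 'n ^ 'm" where
    "E a b z = (\<chi> i j. if j = b then if i = a then z else 0 else 0)" for a b z
  have "linear (E a b)" for a b
    by (rule linearI) (simp_all add: E_def vec_eq_iff)
  hence "bounded_linear (E a b)" for a b
    by (simp add: linear_conv_bounded_linear)
  hence "integrable M (\<lambda>x. \<Sum>a\<in>UNIV. \<Sum>b\<in>UNIV. E a b (f x $ a $ b))"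
    by (intro Bochner_Integration.integrable_sum integrable_bounded_linear[of "E _ _"] assms)
  also have "(\<lambda>x. \<Sum>a\<in>UNIV. \<Sum>b\<in>UNIV. E a b (f x $ a $ b)) = f"
  proof
    fix x
    have "(\<Sum>a\<in>UNIV. \<Sum>b\<in>UNIV. E a b (f x $ a $ b)) $ i $ j = f x $ i $ j" for i j
      by (simp add: E_def)
    thus "(\<Sum>a\<in>UNIV. \<Sum>b\<in>UNIV. E a b (f x $ a $ b)) = f x"
      by (simp add: vec_eq_iff)
  qed
  finally show ?thesis .
qed

lemma mp_inner_direct_sum:
  fixes w :: "'n::finite \<Rightarrow> classical"
  assumes adm: "\<And>i. admissible (w i)"
  shows "mp_inner (direct_sum (\<lambda>i. weight (w i))) P Q $ a $ b =
           (\<Sum>c\<in>UNIV. inner_w (w c) (P $ a $ c) (Q $ b $ c))"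
proof -
  define F where "F = (\<lambda>x. mp_eval P x ** direct_sum (\<lambda>i. weight (w i)) x ** adjoint_mat (mp_eval Q x))"
  have F: "F x $ a $ b = (\<Sum>c\<in>UNIV. poly (P $ a $ c) (of_real x) * of_real (weight (w c) x) *
             cnj (poly (Q $ b $ c) (of_real x)))" for x a b
    by (simp add: F_def matrix_matrix_mult_def mp_eval_def direct_sum_def adjoint_mat_def
        if_distrib[of "\<lambda>t. _ * t"] cong: if_cong)
  have int: "integrable lborel (\<lambda>x. F x $ a $ b)" for a b
    unfolding F by (intro Bochner_Integration.integrable_sum integrable_inner_w adm)
  have "bounded_linear (\<lambda>M :: complex ^ 'n ^ 'n. M $ a $ b)"
    by (intro bounded_linear_compose[OF bounded_linear_vec_nth] bounded_linear_vec_nth)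
  hence "(LINT x|lborel. F x) $ a $ b = (LINT x|lborel. F x $ a $ b)"
    by (rule integral_bounded_linear[symmetric]) (intro integrable_matrix int)
  also have "\<dots> = (\<Sum>c\<in>UNIV. inner_w (w c) (P $ a $ c) (Q $ b $ c))"
    unfolding F inner_w_def
    by (intro Bochner_Integration.integral_sum integrable_inner_w adm)
  finally show ?thesis
    by (simp add: mp_inner_def F_def)
qed

definition diag_ops :: "('n \<Rightarrow> classical) \<Rightarrow> nat \<Rightarrow> 'n::finite mpoly" where
  "diag_ops w n = (\<chi> a b. if a = b then ops (weight (w a)) n else 0)"

lemma monic_mops_diag_ops:
  fixes w :: "'n::finite \<Rightarrow> classical"
  assumes adm: "\<And>i. admissible (w i)"
  shows "monic_mops (direct_sum (\<lambda>i. weight (w i))) (diag_ops w)"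
  unfolding monic_mops_def
proof (intro conjI allI impI)
  fix m n :: nat
  assume "m \<noteq> n"
  hence "inner_w (w c) (diag_ops w m $ a $ c) (diag_ops w n $ b $ c) = 0" for a b c
    using monic_ops_ops[OF adm, of c] by (simp add: diag_ops_def monic_ops_weight)
  thus "mp_inner (direct_sum (\<lambda>i. weight (w i))) (diag_ops w m) (diag_ops w n) = 0"
    by (simp add: vec_eq_iff mp_inner_direct_sum adm)
qed (simp_all add: diag_ops_def degree_ops coeff_ops adm)

text \<open>
  Once $P_k$ is diagonal for all $k < n$, orthogonality of $P_n$ to these $P_k$ says that the $(a,b)$ entry of
  $P_n$ is orthogonal to the scalar polynomials of degree below $n$ for the $b$-th weight.
\<close>

lemma monic_mops_unique:
  fixes w :: "'n::finite \<Rightarrow> classical"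
  assumes adm: "\<And>i. admissible (w i)"
    and P: "monic_mops (direct_sum (\<lambda>i. weight (w i))) P"
  shows "P n = diag_ops w n"
proof (induction n rule: less_induct)
  case (less n)
  have "P n $ a $ b = diag_ops w n $ a $ b" for a b
  proof -
    have "inner_w (w b) (P n $ a $ b) (ops (weight (w b)) k) = 0" if "k < n" for k
    proof -
      have "mp_inner (direct_sum (\<lambda>i. weight (w i))) (P n) (P k) = 0"
        using P that by (simp add: monic_mops_def)
      hence "0 = (\<Sum>c\<in>UNIV. inner_w (w c) (P n $ a $ c) (diag_ops w k $ b $ c))"
        using mp_inner_direct_sum[of w "P n" "P k" a b, OF adm] less.IH[OF that] by simp
      also have "\<dots> = (\<Sum>c\<in>UNIV. if b = c then inner_w (w c) (P n $ a $ c) (ops (weight (w b)) k) else 0)"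
        by (intro sum.cong refl) (simp add: diag_ops_def)
      finally show ?thesis by simp
    qed
    moreover have "degree (P n $ a $ b) \<le> n" "coeff (P n $ a $ b) n = (if a = b then 1 else 0)"
      using P by (auto simp: monic_mops_def)
    ultimately show ?thesis
      using orthogonal_imp_multiple[OF adm[of b] monic_ops_ops[OF adm[of b]], of "P n $ a $ b" n]
      by (simp add: diag_ops_def split: if_splits)
  qed
  thus ?case by (simp add: vec_eq_iff)
qed

lemma mops_direct_sum:
  fixes w :: "'n::finite \<Rightarrow> classical"
  assumes adm: "\<And>i. admissible (w i)"
  shows "mops (direct_sum (\<lambda>i. weight (w i))) = diag_ops w"
  unfolding mops_def
  by (intro the_equality ext monic_mops_diag_ops monic_mops_unique adm)

section \<open>Intertwining operators\<close>

text \<open>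
  For $u = v$ this is the algebra $\mathcal D(v)$.
\<close>

definition intertwiners :: "classical \<Rightarrow> classical \<Rightarrow> diffop set" where
  "intertwiners u v = {D. \<forall>n. \<exists>c. op_act (ops (weight u) n) D = smult c (ops (weight v) n)}"

lemma Dalg_weight: "Dalg (weight v) = intertwiners v v"
  by (simp add: Dalg_def intertwiners_def)

lemma intertwiner_nonraising:
  assumes "admissible u" "admissible v" "D \<in> intertwiners u v"
  shows "nonraising D"
proof (rule nonraising_if_on_basis[where b = "ops (weight u)"])
  show "ops (weight u) n \<noteq> 0 \<and> degree (ops (weight u) n) = n" for n
    using assms(1) by (simp add: ops_nonzero degree_ops)
  show "degree (op_act (ops (weight u) n) D) \<le> n" for n
  proof -
    obtain c where "op_act (ops (weight u) n) D = smult c (ops (weight v) n)"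
      using assms(3) by (auto simp: intertwiners_def)
    thus ?thesis
      using degree_smult_le[of c "ops (weight v) n"] assms(2) by (simp add: degree_ops)
  qed
qed

lemma op_act_intertwiner:
  assumes "admissible u" "admissible v" "D \<in> intertwiners u v"
  shows "op_act (ops (weight u) n) D = smult (poly (eigval D) (of_nat n)) (ops (weight v) n)"
proof -
  obtain c where c: "op_act (ops (weight u) n) D = smult c (ops (weight v) n)"
    using assms(3) by (auto simp: intertwiners_def)
  moreover have "coeff (op_act (ops (weight u) n) D) n = poly (eigval D) (of_nat n)"
    using coeff_op_act[OF intertwiner_nonraising[OF assms], of "ops (weight u) n" n] assms(1)
    by (simp add: degree_ops coeff_ops)
  ultimately show ?thesis
    using assms(2) by (simp add: coeff_ops)
qed

lemma intertwiner_comp: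
  assumes "D \<in> intertwiners u v" "E \<in> intertwiners v z"
  shows "op_comp D E \<in> intertwiners u z"
proof -
  have "\<exists>c. op_act (ops (weight u) n) (op_comp D E) = smult c (ops (weight z) n)" for n
  proof -
    obtain a b where "op_act (ops (weight u) n) D = smult a (ops (weight v) n)"
      "op_act (ops (weight v) n) E = smult b (ops (weight z) n)"
      using assms unfolding intertwiners_def by blast
    hence "op_act (ops (weight u) n) (op_comp D E) = smult (a * b) (ops (weight z) n)"
      by (simp add: op_act_comp op_act_smult_left)
    thus ?thesis ..
  qed
  thus ?thesis by (simp add: intertwiners_def)
qed

lemma intertwiner_add:
  assumes "D \<in> intertwiners u v" "E \<in> intertwiners u v"
  shows "D + E \<in> intertwiners u v"
proof -
  have "\<exists>c. op_act (ops (weight u) n) (D + E) = smult c (ops (weight v) n)" for n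
  proof -
    obtain a b where "op_act (ops (weight u) n) D = smult a (ops (weight v) n)"
      "op_act (ops (weight u) n) E = smult b (ops (weight v) n)"
      using assms unfolding intertwiners_def by blast
    hence "op_act (ops (weight u) n) (D + E) = smult (a + b) (ops (weight v) n)"
      by (simp add: op_act_add smult_add_left)
    thus ?thesis ..
  qed
  thus ?thesis by (simp add: intertwiners_def)
qed

lemma intertwiner_zero: "0 \<in> intertwiners u v"
  unfolding intertwiners_def by (auto intro!: exI[of _ 0])

lemma intertwiner_const: "[:[:a:]:] \<in> intertwiners v v"
  unfolding intertwiners_def by (auto simp: op_act_const)

lemma intertwiner_one: "1 \<in> intertwiners v v"
  using intertwiner_const[of 1 v] by (simp add: one_pCons)

lemma intertwiner_delta: "admissible v \<Longrightarrow> delta v \<in> intertwiners v v"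
  by (auto simp: intertwiners_def op_act_ops_delta)

text \<open>
  If $T$ commutes with the second-order operators, then $p_n \cdot T$ is an eigenpolynomial of $\delta_v$ for
  the $n$-th eigenvalue.
\<close>

lemma intertwinerI_commute:
  assumes "admissible u" "admissible v" "eigval (delta u) = eigval (delta v)"
    and "\<And>p. op_act (op_act p (delta u)) T = op_act (op_act p T) (delta v)"
  shows "T \<in> intertwiners u v"
proof -
  have "op_act (ops (weight u) n) T =
          smult (coeff (op_act (ops (weight u) n) T) n) (ops (weight v) n)" for n
    by (rule eigenpoly_ops[OF assms(2)])
       (simp add: assms(3) assms(4)[symmetric] op_act_ops_delta[OF assms(1)] op_act_smult_left)
  thus ?thesis
    unfolding intertwiners_def by blast
qed

text \<open>
  The operator is $q$ evaluated at $\delta_v$, built by the Horner scheme.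
\<close>

lemma poly_in_delta:
  assumes "admissible v"
  shows "\<exists>C\<in>intertwiners v v. eigval C = pcompose q (eigval (delta v))"
proof (induction q)
  case 0
  show ?case by (rule bexI[OF _ intertwiner_zero]) simp
next
  case (pCons a q)
  then obtain C where C: "C \<in> intertwiners v v" "eigval C = pcompose q (eigval (delta v))"
    by blast
  have "eigval [:[:a:]:] = [:a:]"
    by (simp add: eigval_def falling_poly_def)
  moreover have "eigval (op_comp (delta v) C) = eigval (delta v) * eigval C"
    using assms C intertwiner_nonraising nonraising_delta by (intro eigval_comp) auto
  ultimately show ?case
    using assms C
    by (intro bexI[of _ "[:[:a:]:] + op_comp (delta v) C"] intertwiner_add intertwiner_const
          intertwiner_comp[OF intertwiner_delta])
       (simp_all add: eigval_add pcompose_pCons)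
qed

lemma nonraising_imp_degree_preserving:
  assumes "nonraising D" "\<And>n. poly (eigval D) (of_nat n) \<noteq> 0"
  shows "degree_preserving D"
  unfolding degree_preserving_def
proof (intro allI impI)
  fix p :: "complex poly"
  assume "p \<noteq> 0"
  hence "coeff (op_act p D) (degree p) \<noteq> 0"
    using coeff_op_act[OF assms(1) order_refl, of p] assms(2) by simp
  thus "op_act p D \<noteq> 0 \<and> degree (op_act p D) = degree p"
    using assms(1) unfolding nonraising_def by (metis coeff_0 le_degree order_antisym)
qed

text \<open>
  A pair of intertwiners in opposite directions gives the factorization that a Darboux transformation
  requires.
\<close>

lemma darbouxI:
  assumes "admissible u" "admissible v"
    and "closure {x. weight u x \<noteq> 0} = closure {x. weight v x \<noteq> 0}"
    and "V \<in> intertwiners v u" "N \<in> intertwiners u v"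
    and "\<And>n. poly (eigval V) (of_nat n) \<noteq> 0" "\<And>n. poly (eigval N) (of_nat n) \<noteq> 0"
  shows "darboux (weight u) (weight v)"
  unfolding darboux_def Dalg_weight
proof (intro conjI bexI exI allI)
  show "op_comp V N \<in> intertwiners v v"
    using assms intertwiner_comp by blast
  show "degree_preserving V" "degree_preserving N"
    using nonraising_imp_degree_preserving intertwiner_nonraising[OF assms(2,1,4)]
      intertwiner_nonraising[OF assms(1,2,5)] assms(6,7) by blast+
  show "op_act (ops (weight v) n) V = smult (poly (eigval V) (of_nat n)) (ops (weight u) n)" for n
    using assms by (intro op_act_intertwiner)
qed (use assms in auto)

lemma darboux_refl: "admissible v \<Longrightarrow> darboux (weight v) (weight v)"
  by (rule darbouxI[OF _ _ _ intertwiner_one intertwiner_one]) auto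

section \<open>Endpoints\<close>

text \<open>
  The point $e$ is a zero of the leading coefficient of $\delta$. With $t = x - e$ the operator has the normal
  form $\partial^2\, t(\kappa + \epsilon t) + \partial\, (\kappa(\gamma + 1) + \eta t)$, in which
  $\gamma$ is the exponent of the weight at $e$, the eigenvalues $\epsilon n(n-1) + \eta n$ depend on
  $\epsilon$ and $\eta$ only, and the indicial roots are $0$ and $-\gamma$ if $\kappa \ne 0$.
\<close>

definition endpoint :: "classical \<Rightarrow> complex \<Rightarrow> complex \<Rightarrow> complex \<Rightarrow> complex \<Rightarrow> complex \<Rightarrow> bool" where
  "endpoint v e \<kappa> \<gamma> \<epsilon> \<eta> \<longleftrightarrow>
     delta v = [:0, [:\<kappa> * (\<gamma> + 1) - \<eta> * e, \<eta>:], [:- e, 1:] * [:\<kappa> - \<epsilon> * e, \<epsilon>:]:]"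

lemma endpoint_laguerre: "endpoint (Laguerre \<alpha>) 0 1 (of_real \<alpha>) 0 (-1)"
  by (simp add: endpoint_def)

lemma endpoint_jacobi_left:
  "endpoint (Jacobi \<alpha> \<beta>) (-1) 2 (of_real \<beta>) (-1) (- of_real (\<alpha> + \<beta> + 2))"
  by (simp add: endpoint_def algebra_simps)

lemma endpoint_jacobi_right:
  "endpoint (Jacobi \<alpha> \<beta>) 1 (-2) (of_real \<alpha>) (-1) (- of_real (\<alpha> + \<beta> + 2))"
  by (simp add: endpoint_def algebra_simps)

lemma eigval_endpoint: "endpoint v e \<kappa> \<gamma> \<epsilon> \<eta> \<Longrightarrow> eigval (delta v) = [:0, \<eta> - \<epsilon>, \<epsilon>:]"
  by (simp add: endpoint_def eigval_order2 numeral_2_eq_2)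

lemma coeff_mult_linear:
  fixes r :: "complex poly"
  shows "coeff (r * [:a, b:]) k = a * coeff r k + (case k of 0 \<Rightarrow> 0 | Suc j \<Rightarrow> b * coeff r j)"
  by (simp add: coeff_pCons split: nat.splits)

text \<open>
  In powers of $t = x - e$ the operator sends $t^k$ to
  $\lambda_k t^k + \kappa k (k + \gamma) t^{k-1}$. Comparing coefficients of $t^k$ in
  $p_n \cdot \delta = \lambda_n p_n$ gives the recurrence.
\<close>

lemma taylor_recurrence:
  fixes n k :: nat
  assumes adm: "admissible v" and v: "endpoint v e \<kappa> \<gamma> \<epsilon> \<eta>"
  defines "ev \<equiv> \<lambda>n. poly (eigval (delta v)) (of_nat n)"
    and "q \<equiv> pcompose (ops (weight v) n) [:e, 1:]"
  shows "coeff q (Suc k) * (\<kappa> * of_nat (Suc k) * (\<gamma> + 1 + of_nat k)) = (ev n - ev k) * coeff q k"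
proof -
  define p where "p = ops (weight v) n"
  have q': "pcompose (pderiv p) [:e, 1:] = pderiv q" 
    and q'': "pcompose (pderiv (pderiv p)) [:e, 1:] = pderiv (pderiv q)"
    by (simp_all add: q_def p_def[symmetric] pderiv_pcompose pderiv_pCons)
  have "op_act p (delta v) = smult (ev n) p"
    using op_act_ops_delta[OF adm] by (simp add: p_def ev_def)
  moreover have "op_act p (delta v) = pderiv p * [:\<kappa> * (\<gamma> + 1) - \<eta> * e, \<eta>:] +
                   pderiv (pderiv p) * ([:- e, 1:] * [:\<kappa> - \<epsilon> * e, \<epsilon>:])"
    using v unfolding endpoint_def by (simp only: op_act_order2 mult_zero_right add_0)
  ultimately have "pcompose (pderiv p * [:\<kappa> * (\<gamma> + 1) - \<eta> * e, \<eta>:] +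
                   pderiv (pderiv p) * ([:- e, 1:] * [:\<kappa> - \<epsilon> * e, \<epsilon>:])) [:e, 1:] =
                   pcompose (smult (ev n) p) [:e, 1:]"
    by simp
  also have "pcompose (pderiv p * [:\<kappa> * (\<gamma> + 1) - \<eta> * e, \<eta>:] +
                   pderiv (pderiv p) * ([:- e, 1:] * [:\<kappa> - \<epsilon> * e, \<epsilon>:])) [:e, 1:] =
             pderiv q * [:\<kappa> * (\<gamma> + 1), \<eta>:] + pderiv (pderiv q) * ([:0, 1:] * [:\<kappa>, \<epsilon>:])"
    unfolding pcompose_add pcompose_mult q' q'' by (simp add: pcompose_pCons)
  finally have "coeff (pderiv q * [:\<kappa> * (\<gamma> + 1), \<eta>:] + pderiv (pderiv q) * [:0, 1:] * [:\<kappa>, \<epsilon>:]) k =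
                  coeff (smult (ev n) q) k"
    by (simp add: q_def p_def pcompose_smult mult.assoc)
  moreover have "ev k = (\<eta> - \<epsilon>) * of_nat k + \<epsilon> * of_nat k * of_nat k"
    unfolding ev_def eigval_endpoint[OF v] by (simp add: algebra_simps)
  ultimately show ?thesis
    unfolding coeff_add coeff_mult_linear coeff_smult
    by (cases k) (auto simp: coeff_pderiv algebra_simps split: nat.splits)
qed

lemma taylor_coeff:
  fixes n k :: nat
  assumes adm: "admissible v" and v: "endpoint v e \<kappa> \<gamma> \<epsilon> \<eta>"
  defines "ev \<equiv> \<lambda>n. poly (eigval (delta v)) (of_nat n)"
    and "q \<equiv> pcompose (ops (weight v) n) [:e, 1:]"
  shows "coeff q k * (\<kappa> ^ k * fact k * pochhammer (\<gamma> + 1) k) =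
           poly (ops (weight v) n) e * (\<Prod>i<k. ev n - ev i)"
proof (induction k)
  case 0
  show ?case by (simp add: q_def coeff_pcompose_0)
next
  case (Suc k)
  have "coeff q (Suc k) * (\<kappa> ^ Suc k * fact (Suc k) * pochhammer (\<gamma> + 1) (Suc k)) =
        (coeff q (Suc k) * (\<kappa> * of_nat (Suc k) * (\<gamma> + 1 + of_nat k))) *
        (\<kappa> ^ k * fact k * pochhammer (\<gamma> + 1) k)"
    by (simp add: pochhammer_Suc algebra_simps)
  also have "\<dots> = ((ev n - ev k) * coeff q k) * (\<kappa> ^ k * fact k * pochhammer (\<gamma> + 1) k)"
    using taylor_recurrence[OF adm v, of n k] by (simp only: q_def ev_def)
  also have "\<dots> = poly (ops (weight v) n) e * (\<Prod>i<Suc k. ev n - ev i)"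
    using Suc.IH by (simp add: mult_ac)
  finally show ?case .
qed

text \<open>
  The Taylor coefficient of order $n$ of the monic polynomial is $1$, so the recurrence, solved for the
  coefficient of order $0$, determines the value at $e$.
\<close>

lemma endpoint_value:
  assumes adm: "admissible v" and v: "endpoint v e \<kappa> \<gamma> \<epsilon> \<eta>"
  defines "ev \<equiv> \<lambda>n. poly (eigval (delta v)) (of_nat n)"
  shows "poly (ops (weight v) n) e * (\<Prod>i<n. ev n - ev i) = \<kappa> ^ n * fact n * pochhammer (\<gamma> + 1) n"
proof -
  have "coeff (pcompose (ops (weight v) n) [:e, 1:]) n = 1"
    using lead_coeff_comp[of "[:e, 1:]" "ops (weight v) n"] adm
    by (simp add: degree_pcompose degree_ops coeff_ops)
  thus ?thesis
    using taylor_coeff[OF adm v, of n n] by (simp add: ev_def)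
qed

lemma poly_higher_pderiv: "poly ((pderiv ^^ j) p) e = fact j * coeff (pcompose p [:e, 1:]) j"
  for p :: "complex poly"
proof -
  have "pderiv (pcompose q [:e, 1:]) = pcompose (pderiv q) [:e, 1:]" for q :: "complex poly"
    by (simp add: pderiv_pcompose pderiv_pCons)
  hence "pcompose ((pderiv ^^ j) p) [:e, 1:] = (pderiv ^^ j) (pcompose p [:e, 1:])"
    by (induction j) (simp, metis funpow.simps(2) o_apply)
  hence "poly ((pderiv ^^ j) p) e = coeff ((pderiv ^^ j) (pcompose p [:e, 1:])) 0"
    by (metis coeff_pcompose_0 coeff_pCons_0)
  thus ?thesis
    by (simp add: coeff_higher_pderiv pochhammer_fact)
qed

text \<open>
  Evaluate $p_n \cdot D = c(n)\, q_n$ at the endpoint. The left-hand side is a combination of the Taylor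
  coefficients of $p_n$, each of which is $p_n(e)$ times a polynomial in $\lambda_n$ not depending on
  $n$ otherwise.
\<close>

lemma endpoint_identity:
  assumes adm: "admissible u" "admissible v"
    and u: "endpoint u e \<kappa> \<gamma> \<epsilon> \<eta>" and nz: "\<kappa> \<noteq> 0" "\<And>k. pochhammer (\<gamma> + 1) k \<noteq> 0"
    and D: "D \<in> intertwiners u v"
  shows "\<exists>d. \<forall>n. poly (eigval D) (of_nat n) * poly (ops (weight v) n) e =
           poly (ops (weight u) n) e * poly (pcompose d (eigval (delta u))) (of_nat n)"
proof -
  define ev where "ev = (\<lambda>n. poly (eigval (delta u)) (of_nat n))"
  define \<mu> where "\<mu> = (\<lambda>k. \<kappa> ^ k * fact k * pochhammer (\<gamma> + 1) k)"
  \<comment> \<open>The $j$-th derivative of $p_n$ at $e$ is $p_n(e)\, j! \prod_{i<j} (\lambda_n - \lambda_i) / \mu_j$.\<close>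
  define d where "d = (\<Sum>j\<le>degree D. smult (fact j * poly (coeff D j) e / \<mu> j) (\<Prod>i<j. [:- ev i, 1:]))"
  have "poly (eigval D) (of_nat n) * poly (ops (weight v) n) e =
        poly (ops (weight u) n) e * poly (pcompose d (eigval (delta u))) (of_nat n)" for n
  proof -
    let ?p = "ops (weight u) n"
    have taylor: "poly ((pderiv ^^ j) ?p) e = poly ?p e * (fact j * (\<Prod>i<j. ev n - ev i) / \<mu> j)" for j
    proof -
      have "\<mu> j \<noteq> 0" using nz by (simp add: \<mu>_def)
      moreover have "coeff (pcompose ?p [:e, 1:]) j * \<mu> j = poly ?p e * (\<Prod>i<j. ev n - ev i)"
        unfolding \<mu>_def ev_def by (rule taylor_coeff[OF adm(1) u])
      ultimately show ?thesis
        by (simp add: poly_higher_pderiv field_simps)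
    qed
    have "poly (eigval D) (of_nat n) * poly (ops (weight v) n) e = poly (op_act ?p D) e"
      using op_act_intertwiner[OF adm D] by simp
    also have "\<dots> = (\<Sum>j\<le>degree D. poly ?p e * (fact j * (\<Prod>i<j. ev n - ev i) / \<mu> j) * poly (coeff D j) e)"
      by (simp add: op_act_def poly_sum taylor)
    also have "\<dots> = poly ?p e * poly d (ev n)"
      by (simp add: d_def poly_sum poly_prod sum_distrib_left mult_ac)
    finally show ?thesis
      by (simp add: poly_pcompose ev_def)
  qed
  thus ?thesis by blast
qed

lemma endpoint_value_nonzero:
  assumes "admissible v" "endpoint v e \<kappa> \<gamma> \<epsilon> \<eta>" "\<kappa> \<noteq> 0" "\<And>k. pochhammer (\<gamma> + 1) k \<noteq> 0"
  shows "poly (ops (weight v) n) e \<noteq> 0"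
  using endpoint_value[OF assms(1,2), of n] assms(3,4) by auto

lemma pochhammer_gt_minus_one: "g > -1 \<Longrightarrow> pochhammer (complex_of_real g + 1) k \<noteq> 0"
proof -
  assume "g > -1"
  hence "pochhammer (g + 1) k > 0"
    by (intro pochhammer_pos) auto
  thus ?thesis
    using pochhammer_of_real[of "g + 1" k, where ?'a = complex] by simp
qed

text \<open>
  When the two weights share $\epsilon$ and $\eta$, hence the eigenvalues, the products of differences of
  eigenvalues in the values at the endpoint cancel.
\<close>

lemma endpoint_ratio:
  assumes adm: "admissible u" "admissible v"
    and u: "endpoint u e \<kappa> \<gamma>u \<epsilon> \<eta>" and v: "endpoint v e \<kappa> \<gamma>v \<epsilon> \<eta>"
    and nz: "\<kappa> \<noteq> 0" "\<And>k. pochhammer (\<gamma>u + 1) k \<noteq> 0"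
    and D: "D \<in> intertwiners u v"
  shows "\<exists>d. \<forall>n. poly (eigval D) (of_nat n) * pochhammer (\<gamma>v + 1) n =
           pochhammer (\<gamma>u + 1) n * poly (pcompose d (eigval (delta v))) (of_nat n)"
proof -
  have eq: "eigval (delta u) = eigval (delta v)"
    using u v by (simp add: eigval_endpoint)
  obtain d where d: "\<And>n. poly (eigval D) (of_nat n) * poly (ops (weight v) n) e =
           poly (ops (weight u) n) e * poly (pcompose d (eigval (delta u))) (of_nat n)"
    using endpoint_identity[OF adm u nz D] by blast
  have "poly (eigval D) (of_nat n) * pochhammer (\<gamma>v + 1) n =
           pochhammer (\<gamma>u + 1) n * poly (pcompose d (eigval (delta v))) (of_nat n)" for n
  proof -
    define P where "P = (\<Prod>i<n. poly (eigval (delta v)) (of_nat n) - poly (eigval (delta v)) (of_nat i))"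
    have "poly (eigval D) (of_nat n) * (\<kappa> ^ n * fact n * pochhammer (\<gamma>v + 1) n) =
          P * (poly (eigval D) (of_nat n) * poly (ops (weight v) n) e)"
      unfolding endpoint_value[OF adm(2) v, symmetric] P_def by (simp only: mult_ac)
    also have "\<dots> = (poly (ops (weight u) n) e * P) * poly (pcompose d (eigval (delta v))) (of_nat n)"
      unfolding d eq by (simp only: mult_ac)
    also have "poly (ops (weight u) n) e * P = \<kappa> ^ n * fact n * pochhammer (\<gamma>u + 1) n"
      using endpoint_value[OF adm(1) u, of n] by (simp add: eq P_def)
    finally show ?thesis
      using nz(1) by simp
  qed
  thus ?thesis by blast
qed

section \<open>Polynomial identities that exclude nonzero eigenvalues\<close>

lemma coeff_mult_top:
  fixes A B :: "complex poly"
  assumes "\<forall>k>p. coeff A k = 0" "\<forall>k>q. coeff B k = 0"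
  shows "coeff (A * B) (p + q) = coeff A p * coeff B q"
proof -
  have "coeff A i * coeff B (p + q - i) = (if i = p then coeff A p * coeff B q else 0)" if "i \<le> p + q" for i
    using assms that by (cases i p rule: linorder_cases) auto
  thus ?thesis
    by (simp add: coeff_mult)
qed

text \<open>
  The leading coefficient of $x (f(x+1) - f(x))$ is the degree times that of $f$. The bound \<open>p\<close> may
  exceed the degree, which keeps the induction free of case distinctions.
\<close>

lemma shift_difference:
  fixes f :: "complex poly"
  assumes "\<forall>k>p. coeff f k = 0"
  defines "\<Delta> \<equiv> \<lambda>f. pcompose f [:1, 1:] - f"
  shows "(\<forall>k\<ge>p. coeff (\<Delta> f) k = 0) \<and> coeff (pCons 0 (\<Delta> f)) p = of_nat p * coeff f p"
  using assms(1)
proof (induction p arbitrary: f)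
  case 0
  hence "f = [:coeff f 0:]"
    by (auto simp: poly_eq_iff coeff_pCons split: nat.splits)
  hence "\<Delta> f = 0"
    unfolding \<Delta>_def by (metis diff_self pcompose_const)
  thus ?case by simp
next
  case (Suc p)
  obtain a g where f: "f = pCons a g"
    by (cases f)
  have g: "\<forall>k>p. coeff g k = 0"
    using Suc.prems by (auto simp: f)
  have \<Delta>f: "\<Delta> f = pCons 0 (\<Delta> g) + \<Delta> g + g"
    by (simp add: \<Delta>_def f pcompose_pCons algebra_simps)
  note IH = Suc.IH[OF g]
  have "coeff (\<Delta> f) k = 0" if "k \<ge> Suc p" for k
    using that IH g by (auto simp: \<Delta>f coeff_pCons split: nat.splits)
  moreover have "coeff (\<Delta> f) p = of_nat (Suc p) * coeff g p"
    unfolding \<Delta>f using IH by (simp add: algebra_simps)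
  hence "coeff (\<Delta> f) p = of_nat (Suc p) * coeff f (Suc p)"
    by (simp add: f)
  ultimately show ?case by simp
qed

text \<open>
  Dividing the hypothesis at $n + 1$ by the one at $n$ gives the polynomial identity
  $c(x+1)\, d(x)\, (x+b) = d(x+1)\, c(x)\, (x+a)$. Both sides have the same leading coefficient, and the
  next one yields $\deg c + b = \deg d + a$.
\<close>

lemma pochhammer_ratio_rational:
  fixes c d :: "complex poly"
  assumes eq: "\<And>n. poly c (of_nat n) * pochhammer b n = pochhammer a n * poly d (of_nat n)"
    and nz: "\<And>n. pochhammer a n \<noteq> 0" "\<And>n. pochhammer b n \<noteq> 0" and "c \<noteq> 0"
  shows "a - b \<in> \<int>"
proof -
  define \<Delta> where "\<Delta> = (\<lambda>f. pcompose f [:1, 1:] - f :: complex poly)"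
  have "d \<noteq> 0"
  proof
    assume "d = 0"
    hence "c = 0"
      using eq nz by (intro poly_eqI_nat) auto
    thus False using \<open>c \<noteq> 0\<close> by simp
  qed
  have "pcompose c [:1, 1:] * d * [:b, 1:] = pcompose d [:1, 1:] * c * [:a, 1:]"
  proof (rule poly_eqI_nat)
    fix n :: nat
    define x where "x = complex_of_nat n"
    have 1: "poly c (1 + x) * (pochhammer b n * (b + x)) = pochhammer a n * (a + x) * poly d (1 + x)"
      using eq[of "Suc n"] by (simp add: pochhammer_Suc x_def)
    have 2: "poly c x * pochhammer b n = pochhammer a n * poly d x"
      using eq[of n] by (simp add: x_def)
    have "(pochhammer a n * pochhammer b n) * (poly c (1 + x) * poly d x * (b + x)) =
          (pochhammer a n * pochhammer b n) * (poly d (1 + x) * poly c x * (a + x))"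
      using 1 2 by algebra
    hence "poly c (1 + x) * poly d x * (b + x) = poly d (1 + x) * poly c x * (a + x)"
      using nz by simp
    thus "poly (pcompose c [:1, 1:] * d * [:b, 1:]) (of_nat n) =
          poly (pcompose d [:1, 1:] * c * [:a, 1:]) (of_nat n)"
      by (simp add: poly_pcompose algebra_simps flip: x_def)
  qed
  moreover have "pcompose f [:1, 1:] = \<Delta> f + f" for f :: "complex poly"
    by (simp add: \<Delta>_def)
  ultimately have "(\<Delta> c + c) * d * [:b, 1:] - (\<Delta> d + d) * c * [:a, 1:] = 0"
    by simp
  also have "(\<Delta> c + c) * d * [:b, 1:] - (\<Delta> d + d) * c * [:a, 1:] =
     pCons 0 (\<Delta> c) * d + smult b (\<Delta> c * d) - pCons 0 (\<Delta> d) * c - smult a (\<Delta> d * c) + smult (b - a) (c * d)"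
    by (simp add: algebra_simps smult_add_right smult_diff_left)
  finally have eq0: "pCons 0 (\<Delta> c) * d + smult b (\<Delta> c * d) - pCons 0 (\<Delta> d) * c - smult a (\<Delta> d * c) +
      smult (b - a) (c * d) = 0" .
  define p q where "p = degree c" and "q = degree d"
  have c: "\<forall>k>p. coeff c k = 0" and d: "\<forall>k>q. coeff d k = 0"
    by (simp_all add: p_def q_def coeff_eq_0)
  have \<Delta>c: "(\<forall>k\<ge>p. coeff (\<Delta> c) k = 0)" "coeff (pCons 0 (\<Delta> c)) p = of_nat p * coeff c p"
    and \<Delta>d: "(\<forall>k\<ge>q. coeff (\<Delta> d) k = 0)" "coeff (pCons 0 (\<Delta> d)) q = of_nat q * coeff d q"
    using shift_difference[OF c] shift_difference[OF d] by (simp_all add: \<Delta>_def)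
  have "coeff (pCons 0 (\<Delta> c) * d) (p + q) = of_nat p * coeff c p * coeff d q"
    by (subst coeff_mult_top) (use c d \<Delta>c in \<open>auto simp: coeff_pCons split: nat.splits\<close>)
  moreover have "coeff (pCons 0 (\<Delta> d) * c) (p + q) = of_nat q * coeff d q * coeff c p"
    by (subst add.commute, subst coeff_mult_top) (use c d \<Delta>d in \<open>auto simp: coeff_pCons split: nat.splits\<close>)
  moreover have "coeff (\<Delta> c * d) (p + q) = 0"
    by (subst coeff_mult_top) (use c d \<Delta>c in auto)
  moreover have "coeff (\<Delta> d * c) (p + q) = 0"
    by (subst add.commute, subst coeff_mult_top) (use c d \<Delta>d in auto)
  moreover have "coeff (c * d) (p + q) = coeff c p * coeff d q"
    by (rule coeff_mult_top[OF c d])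
  ultimately have "(of_nat p - of_nat q + (b - a)) * (coeff c p * coeff d q) = 0"
    using arg_cong[OF eq0, of "\<lambda>f. coeff f (p + q)"] by (simp add: algebra_simps)
  moreover have "coeff c p * coeff d q \<noteq> 0"
    using \<open>c \<noteq> 0\<close> \<open>d \<noteq> 0\<close> by (simp add: p_def q_def)
  ultimately have "of_nat p - of_nat q + (b - a) = 0"
    by (metis mult_eq_0_iff)
  hence "a - b = of_nat p - of_nat q"
    by (simp add: algebra_simps)
  thus ?thesis by simp
qed

text \<open>
  Otherwise $s\,n\,d(L)$ would be a polynomial in $L$, but its degree is odd.
\<close>

lemma quadratic_parity:
  fixes d d' :: "complex poly"
  assumes L: "degree L = 2" and "s \<noteq> 0"
    and eq: "(L + [:0, s:]) * pcompose d L = pcompose d' L"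
  shows "d = 0"
proof (rule ccontr)
  assume "d \<noteq> 0"
  have "[:0, s:] * pcompose d L = pcompose (d' - [:0, 1:] * d) L"
    using eq by (simp add: pcompose_diff pcompose_mult pcompose_pCons algebra_simps)
  hence "degree ([:0, s:] * pcompose d L) = degree (pcompose (d' - [:0, 1:] * d) L)"
    by simp
  moreover have "pcompose d L \<noteq> 0"
    using L \<open>d \<noteq> 0\<close> by (auto dest!: pcompose_eq_0)
  hence "degree ([:0, s:] * pcompose d L) = 1 + degree d * 2"
    using \<open>s \<noteq> 0\<close> L by (subst degree_mult_eq) (auto simp: degree_pcompose)
  ultimately have "1 + degree d * 2 = degree (d' - [:0, 1:] * d) * 2"
    by (simp add: degree_pcompose L)
  thus False by presburger
qed

section \<open>The operators connecting equivalent weights\<close>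

lemma nonraising_order1: "nonraising [:[:a:], [:b, c:]:]"
  unfolding nonraising_def
proof
  fix p :: "complex poly"
  have "degree (pderiv p * [:b, c:]) \<le> degree p"
  proof (cases "degree p = 0")
    case True
    hence "pderiv p = 0" by (simp add: pderiv_eq_0_iff)
    thus ?thesis by simp
  next
    case False
    have "degree (pderiv p * [:b, c:]) \<le> degree (pderiv p) + degree [:b, c:]"
      by (rule degree_mult_le)
    also have "\<dots> \<le> degree p"
      using False by (simp add: degree_pderiv)
    finally show ?thesis .
  qed
  moreover have "degree (p * [:a:]) \<le> degree p"
    using degree_mult_le[of p "[:a:]"] by simp
  ultimately show "degree (op_act p [:[:a:], [:b, c:]:]) \<le> degree p"
    unfolding op_act_order1 by (intro degree_add_le)
qed

lemma nonraising_one: "nonraising 1"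
  by (simp add: nonraising_def)

lemma nonraising_op_rising: "nonraising (op_rising [:b, c:] a k)"
  by (induction k) (simp_all add: nonraising_one nonraising_comp nonraising_order1 del: of_nat_Suc)

lemma poly_eigval_op_rising:
  "poly (eigval (op_rising [:b, 1:] c k)) (of_nat n) = pochhammer (of_nat n + c + 1) k"
proof (induction k)
  case (Suc k)
  show ?case
    by (simp add: eigval_comp nonraising_order1 nonraising_op_rising eigval_order1 Suc.IH
        pochhammer_Suc algebra_simps)
qed simp

text \<open>
  In powers of $t = x - e$ the operator multiplies $t^k$ by $k + \gamma + 1$, which is the factor needed to
  turn the coefficient $\kappa k (k + \gamma + 1)$ of $t^{k-1}$ in $t^k \cdot \delta_u$ into the
  coefficient $\kappa k (k + \gamma)$ belonging to $\delta_v$.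
\<close>

lemma rising_step:
  assumes adm: "admissible u" "admissible v"
    and u: "endpoint u e \<kappa> (\<gamma> + 1) \<epsilon> \<eta>" and v: "endpoint v e \<kappa> \<gamma> \<epsilon> \<eta>"
  shows "[:[:\<gamma> + 1:], [:- e, 1:]:] \<in> intertwiners u v"
proof (rule intertwinerI_commute[OF adm])
  show "eigval (delta u) = eigval (delta v)"
    using u v by (simp add: eigval_endpoint)
  define t K E H G where "t = [:- e, 1:]" and "K = [:\<kappa>:]" and "E = [:\<epsilon>:]" and "H = [:\<eta>:]"
    and "G = [:\<gamma>:]"
  have [simp]: "pderiv t = 1" "pderiv K = 0" "pderiv E = 0" "pderiv H = 0" "pderiv G = 0"
    by (simp_all add: t_def K_def E_def H_def G_def pderiv_pCons)
  have du: "delta u = [:0, K * (G + 1 + 1) + H * t, t * (K + E * t):]"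
    using u by (simp add: endpoint_def t_def K_def E_def H_def G_def one_pCons algebra_simps)
  have dv: "delta v = [:0, K * (G + 1) + H * t, t * (K + E * t):]"
    using v by (simp add: endpoint_def t_def K_def E_def H_def G_def one_pCons algebra_simps)
  have T: "[:[:\<gamma> + 1:], [:- e, 1:]:] = [:G + 1, t:]"
    by (simp add: G_def t_def one_pCons)
  show "op_act (op_act p (delta u)) [:[:\<gamma> + 1:], [:- e, 1:]:] =
        op_act (op_act p [:[:\<gamma> + 1:], [:- e, 1:]:]) (delta v)" for p
    unfolding du dv T op_act_order1 op_act_order2
    by (simp add: pderiv_mult pderiv_add algebra_simps)
qed

lemma lowering_step_laguerre:
  assumes "\<alpha> > -1"
  shows "[:1, -1:] \<in> intertwiners (Laguerre \<alpha>) (Laguerre (\<alpha> + 1))"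
proof (rule intertwinerI_commute)
  show "eigval (delta (Laguerre \<alpha>)) = eigval (delta (Laguerre (\<alpha> + 1)))"
    by (simp only: eigval_delta)
  define X A where "X = [:0, 1 :: complex:]" and "A = [:complex_of_real \<alpha>:]"
  have [simp]: "pderiv X = 1" "pderiv A = 0"
    by (simp_all add: X_def A_def pderiv_pCons)
  have d: "delta (Laguerre \<alpha>) = [:0, A + 1 - X, X:]" "delta (Laguerre (\<alpha> + 1)) = [:0, A + 1 + 1 - X, X:]"
    by (simp_all add: X_def A_def one_pCons)
  show "op_act (op_act p (delta (Laguerre \<alpha>))) [:1, -1:] =
        op_act (op_act p [:1, -1:]) (delta (Laguerre (\<alpha> + 1)))" for p
    unfolding d op_act_order1 op_act_order2
    by (simp add: pderiv_mult pderiv_add pderiv_diff pderiv_minus algebra_simps)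
qed (use assms in auto)

lemma op_power_laguerre:
  "\<alpha> > -1 \<Longrightarrow> op_power [:1, -1:] k \<in> intertwiners (Laguerre \<alpha>) (Laguerre (\<alpha> + real k))"
proof (induction k arbitrary: \<alpha>)
  case 0
  show ?case by (simp add: intertwiner_one)
next
  case (Suc k)
  have "op_power [:1, -1:] k \<in> intertwiners (Laguerre (\<alpha> + 1)) (Laguerre (\<alpha> + 1 + real k))"
    using Suc.prems by (intro Suc.IH) auto
  from intertwiner_comp[OF lowering_step_laguerre[OF Suc.prems] this] show ?case
    by (simp add: add_ac)
qed

lemma eigval_op_power: "eigval (op_power [:1, -1:] k) = 1"
proof -
  have *: "nonraising [:1, -1:]"
    using nonraising_order1[of 1 "-1" 0] by (simp add: one_pCons)
  have "eigval [:1, -1:] = 1"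
    by (simp add: eigval_order1)
  hence "eigval (op_power [:1, -1:] k) = 1 \<and> nonraising (op_power [:1, -1:] k)"
    by (induction k) (simp_all add: nonraising_one nonraising_comp * eigval_comp)
  thus ?thesis by blast
qed

lemma op_rising_laguerre:
  assumes "\<alpha> > -1"
  shows "op_rising [:0, 1:] (of_real \<alpha>) k \<in> intertwiners (Laguerre (\<alpha> + real k)) (Laguerre \<alpha>)"
proof (induction k)
  case 0
  show ?case by (simp add: intertwiner_one)
next
  case (Suc k)
  have "[:[:of_real (\<alpha> + real k) + 1:], [:- 0, 1:]:] \<in>
          intertwiners (Laguerre (\<alpha> + real (Suc k))) (Laguerre (\<alpha> + real k))"
    by (rule rising_step[where \<kappa> = 1 and \<epsilon> = 0 and \<eta> = "-1"])
       (use assms endpoint_laguerre[of "\<alpha> + real (Suc k)"] endpoint_laguerre[of "\<alpha> + real k"] in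
         \<open>auto simp: add_ac\<close>)
  from intertwiner_comp[OF this Suc.IH] show ?case
    by (simp add: add_ac)
qed

text \<open>
  A single step lowers the exponent at $-1$ and raises the one at $1$: the sum of the exponents has to stay
  fixed for the eigenvalues to agree.
\<close>

lemma op_rising_jacobi_left:
  assumes "\<alpha> > -1" "\<beta> > -1"
  shows "op_rising [:1, 1:] (of_real \<beta>) k \<in>
           intertwiners (Jacobi \<alpha> (\<beta> + real k)) (Jacobi (\<alpha> + real k) \<beta>)"
  using assms(1)
proof (induction k arbitrary: \<alpha>)
  case 0
  show ?case by (simp add: intertwiner_one)
next
  case (Suc k)
  have "[:[:of_real (\<beta> + real k) + 1:], [:- (-1), 1:]:] \<in>
          intertwiners (Jacobi \<alpha> (\<beta> + real (Suc k))) (Jacobi (\<alpha> + 1) (\<beta> + real k))"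
    by (rule rising_step[where \<kappa> = 2 and \<epsilon> = "-1" and \<eta> = "- of_real (\<alpha> + (\<beta> + real (Suc k)) + 2)"])
       (use Suc.prems assms(2) endpoint_jacobi_left[of \<alpha> "\<beta> + real (Suc k)"]
         endpoint_jacobi_left[of "\<alpha> + 1" "\<beta> + real k"] in \<open>auto simp: add_ac\<close>)
  moreover have "op_rising [:1, 1:] (of_real \<beta>) k \<in>
          intertwiners (Jacobi (\<alpha> + 1) (\<beta> + real k)) (Jacobi (\<alpha> + 1 + real k) \<beta>)"
    using Suc.prems by (intro Suc.IH) auto
  ultimately show ?case
    using intertwiner_comp by (fastforce simp: add_ac)
qed

lemma op_rising_jacobi_right:
  assumes "\<alpha> > -1" "\<beta> > -1"
  shows "op_rising [:-1, 1:] (of_real \<alpha>) k \<in>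
           intertwiners (Jacobi (\<alpha> + real k) \<beta>) (Jacobi \<alpha> (\<beta> + real k))"
  using assms(2)
proof (induction k arbitrary: \<beta>)
  case 0
  show ?case by (simp add: intertwiner_one)
next
  case (Suc k)
  have "[:[:of_real (\<alpha> + real k) + 1:], [:- 1, 1:]:] \<in>
          intertwiners (Jacobi (\<alpha> + real (Suc k)) \<beta>) (Jacobi (\<alpha> + real k) (\<beta> + 1))"
    by (rule rising_step[where \<kappa> = "-2" and \<epsilon> = "-1" and \<eta> = "- of_real ((\<alpha> + real (Suc k)) + \<beta> + 2)"])
       (use Suc.prems assms(1) endpoint_jacobi_right[of "\<alpha> + real (Suc k)" \<beta>]
         endpoint_jacobi_right[of "\<alpha> + real k" "\<beta> + 1"] in \<open>auto simp: add_ac\<close>)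
  moreover have "op_rising [:-1, 1:] (of_real \<alpha>) k \<in>
          intertwiners (Jacobi (\<alpha> + real k) (\<beta> + 1)) (Jacobi \<alpha> (\<beta> + 1 + real k))"
    using Suc.prems by (intro Suc.IH) auto
  ultimately show ?case
    using intertwiner_comp by (fastforce simp: add_ac)
qed

lemma poly_eigval_op_rising_nonzero:
  assumes "c > -1"
  shows "poly (eigval (op_rising [:b, 1:] (of_real c) k)) (of_nat n) \<noteq> 0"
  using pochhammer_gt_minus_one[of "real n + c" k] assms
  by (simp add: poly_eigval_op_rising)

lemma support_laguerre: "{x. weight (Laguerre \<alpha>) x \<noteq> 0} = {0<..}"
  by auto

lemma support_jacobi: "{x. weight (Jacobi \<alpha> \<beta>) x \<noteq> 0} = {-1<..<1}"
  by auto

lemma darboux_laguerre: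
  assumes "\<alpha> > -1"
  shows "darboux (weight (Laguerre \<alpha>)) (weight (Laguerre (\<alpha> + real k)))"
    and "darboux (weight (Laguerre (\<alpha> + real k))) (weight (Laguerre \<alpha>))"
  using assms
  by (intro darbouxI[OF _ _ _ op_rising_laguerre op_power_laguerre]
        darbouxI[OF _ _ _ op_power_laguerre op_rising_laguerre];
      simp only: support_laguerre poly_eigval_op_rising_nonzero eigval_op_power; simp)+

lemma darboux_jacobi:
  assumes "\<alpha> > -1" "\<beta> > -1"
  shows "darboux (weight (Jacobi \<alpha> (\<beta> + real k))) (weight (Jacobi (\<alpha> + real k) \<beta>))"
    and "darboux (weight (Jacobi (\<alpha> + real k) \<beta>)) (weight (Jacobi \<alpha> (\<beta> + real k)))"
  using assms
  by (intro darbouxI[OF _ _ _ op_rising_jacobi_left op_rising_jacobi_right]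
        darbouxI[OF _ _ _ op_rising_jacobi_right op_rising_jacobi_left];
      simp only: support_jacobi poly_eigval_op_rising_nonzero; simp)+

lemma minus_real_notin_Nats: "k \<noteq> 0 \<Longrightarrow> - real k \<notin> \<nat>"
  by (auto elim!: Nats_cases)

lemma T_op_same [simp]: "T_op u u = 1"
  by (simp add: T_op_def)

lemma T_op_laguerre:
  assumes "\<alpha> > -1"
  shows "T_op (Laguerre \<alpha>) (Laguerre (\<alpha> + real k)) = op_power [:1, -1:] k"
    and "T_op (Laguerre (\<alpha> + real k)) (Laguerre \<alpha>) = op_rising [:0, 1:] (of_real \<alpha>) k"
  using darboux_laguerre[OF assms, of k] minus_real_notin_Nats[of k]
  by (cases "k = 0"; simp add: T_op_def del: weight.simps)+

lemma T_op_jacobi: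
  assumes "\<alpha> > -1" "\<beta> > -1"
  shows "T_op (Jacobi \<alpha> (\<beta> + real k)) (Jacobi (\<alpha> + real k) \<beta>) = op_rising [:1, 1:] (of_real \<beta>) k"
    and "T_op (Jacobi (\<alpha> + real k) \<beta>) (Jacobi \<alpha> (\<beta> + real k)) = op_rising [:-1, 1:] (of_real \<alpha>) k"
  using darboux_jacobi[OF assms, of k] minus_real_notin_Nats[of k]
  by (cases "k = 0"; simp add: T_op_def del: weight.simps)+

lemma T_op_laguerre_cases:
  assumes "T_op (Laguerre a) (Laguerre a') \<noteq> 0"
  obtains k where "a' = a + real k" | k where "a = a' + real k"
proof -
  have "a = a' \<or> a' - a \<in> \<nat> \<or> a - a' \<in> \<nat>"
    using assms by (auto simp: T_op_def split: if_splits)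
  thus ?thesis
  proof (elim disjE)
    assume "a = a'"
    thus ?thesis using that(1)[of 0] by simp
  next
    assume "a' - a \<in> \<nat>"
    then obtain k where "a' - a = real k" by (auto elim: Nats_cases)
    thus ?thesis by (intro that(1)[of k]) simp
  next
    assume "a - a' \<in> \<nat>"
    then obtain k where "a - a' = real k" by (auto elim: Nats_cases)
    thus ?thesis by (intro that(2)[of k]) simp
  qed
qed

lemma T_op_jacobi_cases:
  assumes "T_op (Jacobi a b) (Jacobi a' b') \<noteq> 0"
  obtains k where "a' = a + real k" "b = b' + real k" | k where "a = a' + real k" "b' = b + real k"
proof -
  have "a = a' \<and> b = b' \<or> a + b = a' + b' \<and> a' - a \<in> \<nat> \<or> a + b = a' + b' \<and> a - a' \<in> \<nat>"
    using assms by (auto simp: T_op_def split: if_splits)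
  thus ?thesis
  proof (elim disjE conjE)
    assume "a = a'" "b = b'"
    thus ?thesis using that(1)[of 0] by simp
  next
    assume *: "a + b = a' + b'" "a' - a \<in> \<nat>"
    then obtain k where "a' - a = real k" by (auto elim: Nats_cases)
    thus ?thesis using * by (intro that(1)[of k]) auto
  next
    assume *: "a + b = a' + b'" "a - a' \<in> \<nat>"
    then obtain k where "a - a' = real k" by (auto elim: Nats_cases)
    thus ?thesis using * by (intro that(2)[of k]) auto
  qed
qed

lemma T_op_intertwiner:
  assumes "admissible u" "admissible v" "same_type u v"
  shows "T_op u v \<in> intertwiners u v"
proof (cases "T_op u v = 0")
  case True
  thus ?thesis by (simp add: intertwiner_zero)
next
  case nz: False
  show ?thesis
  proof (cases u)
    case u: (Hermite b)
    then obtain b' where v: "v = Hermite b'"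
      using assms(3) by (cases v) auto
    have "u = v"
      using nz by (auto simp: T_op_def u v split: if_splits)
    thus ?thesis by (simp add: intertwiner_one)
  next
    case u: (Laguerre a)
    then obtain a' where v: "v = Laguerre a'"
      using assms(3) by (cases v) auto
    from nz show ?thesis
      unfolding u v
      by (cases rule: T_op_laguerre_cases)
         (use assms op_power_laguerre op_rising_laguerre in \<open>auto simp: u v T_op_laguerre\<close>)
  next
    case u: (Jacobi a b)
    then obtain a' b' where v: "v = Jacobi a' b'"
      using assms(3) by (cases v) auto
    from nz show ?thesis
      unfolding u v
      by (cases rule: T_op_jacobi_cases)
         (use assms op_rising_jacobi_left op_rising_jacobi_right in \<open>auto simp: u v T_op_jacobi\<close>)
  qed
qed

section \<open>Eigenvalues of intertwiners\<close>

lemma poly_algI: "pcompose q p \<in> poly_alg p"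
  by (simp add: poly_alg_def)

lemma poly_alg_linear:
  assumes "c \<noteq> 0"
  shows "poly_alg [:0, c:] = UNIV"
proof -
  have "f \<in> poly_alg [:0, c:]" for f
  proof -
    have "pcompose (pcompose f [:0, 1 / c:]) [:0, c:] = f"
      using assms by (simp add: pcompose_assoc[symmetric] pcompose_pCons)
    thus ?thesis by (metis poly_algI)
  qed
  thus ?thesis by blast
qed

lemma poly_alg_minus: "poly_alg (- p) = poly_alg p"
proof -
  have "pcompose q (- p) = pcompose (pcompose q [:0, -1:]) p" for q p :: "complex poly"
    by (simp add: pcompose_assoc[symmetric] pcompose_pCons)
  hence "poly_alg (- p) \<subseteq> poly_alg p" for p :: "complex poly"
    by (auto simp: poly_alg_def)
  from this[of p] this[of "- p"] show ?thesis by simp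
qed

text \<open>
  The quotient $(c+k+1)_n / (c+1)_n$ in \<open>endpoint_ratio\<close> equals $(n+c+1)_k / (c+1)_k$, whose numerator is the
  eigenvalue of the rising operator.
\<close>

lemma rising_factor:
  assumes adm: "admissible u" "admissible v"
    and u: "endpoint u e \<kappa> (of_real c + of_nat k) \<epsilon> \<eta>" and v: "endpoint v e \<kappa> (of_real c) \<epsilon> \<eta>"
    and c: "c > -1" and \<kappa>: "\<kappa> \<noteq> 0" and D: "D \<in> intertwiners u v"
  shows "\<exists>f\<in>poly_alg (eigval (delta v)). eigval D = eigval (op_rising [:b, 1:] (of_real c) k) * f"
proof -
  let ?c = "complex_of_real c"
  have nz: "pochhammer (?c + 1) m \<noteq> 0" for m
    using c by (rule pochhammer_gt_minus_one)
  have "pochhammer (?c + of_nat k + 1) m \<noteq> 0" for m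
    using pochhammer_gt_minus_one[of "c + real k" m] c by simp
  from endpoint_ratio[OF adm u v \<kappa> this D] obtain d where
    d: "\<And>n. poly (eigval D) (of_nat n) * pochhammer (?c + 1) n =
           pochhammer (?c + of_nat k + 1) n * poly (pcompose d (eigval (delta v))) (of_nat n)"
    by blast
  define f where "f = pcompose (smult (1 / pochhammer (?c + 1) k) d) (eigval (delta v))"
  have "eigval D = eigval (op_rising [:b, 1:] ?c k) * f"
  proof (rule poly_eqI_nat)
    fix n
    have "pochhammer (?c + 1) n * pochhammer (?c + 1 + of_nat n) k =
          pochhammer (?c + 1) k * pochhammer (?c + 1 + of_nat k) n"
      unfolding pochhammer_product'[symmetric] by (simp add: add.commute)
    hence "pochhammer (?c + 1) k * pochhammer (?c + of_nat k + 1) n =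
           pochhammer (?c + 1) n * pochhammer (of_nat n + ?c + 1) k"
      by (simp add: add_ac)
    hence "pochhammer (?c + 1) n * (pochhammer (?c + 1) k * poly (eigval D) (of_nat n)) =
           pochhammer (?c + 1) n * (pochhammer (of_nat n + ?c + 1) k *
             poly (pcompose d (eigval (delta v))) (of_nat n))"
      using d[of n] by algebra
    hence "pochhammer (?c + 1) k * poly (eigval D) (of_nat n) =
           pochhammer (of_nat n + ?c + 1) k * poly (pcompose d (eigval (delta v))) (of_nat n)"
      using nz[of n] by simp
    thus "poly (eigval D) (of_nat n) = poly (eigval (op_rising [:b, 1:] ?c k) * f) (of_nat n)"
      using nz[of k] by (simp add: f_def poly_eigval_op_rising pcompose_smult field_simps)
  qed
  thus ?thesis
    unfolding f_def using poly_algI by blast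
qed

lemma exponent_difference:
  assumes adm: "admissible u" "admissible v"
    and u: "endpoint u e \<kappa> (of_real a) \<epsilon> \<eta>" and v: "endpoint v e \<kappa> (of_real b) \<epsilon> \<eta>"
    and ab: "a > -1" "b > -1" and \<kappa>: "\<kappa> \<noteq> 0" and D: "D \<in> intertwiners u v" "eigval D \<noteq> 0"
  obtains k where "a = b + real k" | k where "b = a + real k"
proof -
  obtain d where
    d: "\<And>n. poly (eigval D) (of_nat n) * pochhammer (of_real b + 1) n =
           pochhammer (of_real a + 1) n * poly (pcompose d (eigval (delta v))) (of_nat n)"
    using endpoint_ratio[OF adm u v \<kappa> pochhammer_gt_minus_one[OF ab(1)] D(1)] by blast
  have "(complex_of_real a + 1) - (of_real b + 1) \<in> \<int>"
    by (rule pochhammer_ratio_rational[OF d]) (use ab pochhammer_gt_minus_one D(2) in auto)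
  hence "complex_of_real (a - b) \<in> \<int>" by simp
  then obtain m where m: "a - b = of_int m"
    by (auto elim!: Ints_cases) (metis of_real_eq_iff of_real_of_int_eq of_real_diff)
  show ?thesis
  proof (cases "m \<ge> 0")
    case True
    thus ?thesis using m by (intro that(1)[of "nat m"]) simp
  next
    case False
    thus ?thesis using m by (intro that(2)[of "nat (- m)"]) simp
  qed
qed

text \<open>
  The eigenvalues $\lambda^u_n$ and $\lambda^v_n$ differ by a multiple $s n$, with $s \ne 0$ if the sums differ.
  Comparing the endpoint identities of $D$ and of $D\delta_v$, whose eigenvalue is
  $c(n)\, \lambda^v_n$, shows that $(\lambda^u_n + s n)\, d(\lambda^u_n)$ is a polynomial in
  $\lambda^u_n$.
\<close>

lemma jacobi_sum_of_exponents:
  assumes adm: "admissible (Jacobi a b)" "admissible (Jacobi a' b')"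
    and D: "D \<in> intertwiners (Jacobi a b) (Jacobi a' b')" "eigval D \<noteq> 0"
  shows "a + b = a' + b'"
proof (rule ccontr)
  assume neq: "a + b \<noteq> a' + b'"
  define u v where "u = Jacobi a b" and "v = Jacobi a' b'"
  define L where "L = eigval (delta u)"
  define s where "s = complex_of_real (a + b - (a' + b'))"
  have a: "a > -1" "a' > -1" using adm by auto
  have D': "op_comp D (delta v) \<in> intertwiners u v"
    using intertwiner_comp[OF D(1) intertwiner_delta[OF adm(2)]] by (simp only: u_def v_def)
  have "eigval (delta v) = L + [:0, s:]"
    unfolding u_def v_def L_def s_def eigval_delta by (simp add: algebra_simps)
  hence eig': "eigval (op_comp D (delta v)) = eigval D * (L + [:0, s:])"
    by (simp only: eigval_comp[OF intertwiner_nonraising[OF adm D(1)] nonraising_delta])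
  note e = endpoint_identity[OF adm endpoint_jacobi_right _ pochhammer_gt_minus_one[OF a(1)]]
  obtain d where d: "\<And>n. poly (eigval D) (of_nat n) * poly (ops (weight v) n) 1 =
      poly (ops (weight u) n) 1 * poly (pcompose d L) (of_nat n)"
    using e[OF _ D(1)] unfolding u_def v_def L_def by auto
  obtain d' where d': "\<And>n. poly (eigval (op_comp D (delta v))) (of_nat n) * poly (ops (weight v) n) 1 =
      poly (ops (weight u) n) 1 * poly (pcompose d' L) (of_nat n)"
    using e[OF _ D'[unfolded u_def v_def]] unfolding u_def v_def L_def by auto
  have nz: "poly (ops (weight u) n) 1 \<noteq> 0" "poly (ops (weight v) n) 1 \<noteq> 0" for n
    unfolding u_def v_def
    by (rule endpoint_value_nonzero[OF adm(1) endpoint_jacobi_right _ pochhammer_gt_minus_one[OF a(1)]]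
          endpoint_value_nonzero[OF adm(2) endpoint_jacobi_right _ pochhammer_gt_minus_one[OF a(2)]]; simp)+
  have "(L + [:0, s:]) * pcompose d L = pcompose d' L"
  proof (rule poly_eqI_nat)
    fix n
    have "poly (ops (weight u) n) 1 * (poly (L + [:0, s:]) (of_nat n) * poly (pcompose d L) (of_nat n)) =
          poly (ops (weight u) n) 1 * poly (pcompose d' L) (of_nat n)"
      using d[of n] d'[of n] unfolding eig' poly_mult by algebra
    thus "poly ((L + [:0, s:]) * pcompose d L) (of_nat n) = poly (pcompose d' L) (of_nat n)"
      using nz by simp
  qed
  moreover have "degree L = 2"
    unfolding L_def u_def eigval_delta by simp
  moreover have "s \<noteq> 0"
    using neq unfolding s_def of_real_eq_0_iff by simp
  ultimately have "d = 0"
    by (rule quadratic_parity[rotated 2])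
  hence "eigval D = 0"
    using d nz by (intro poly_eqI_nat) simp
  thus False using D(2) by simp
qed

lemma poly_op_act:
  "poly (op_act p D) e = (\<Sum>j\<le>degree D. fact j * coeff (pcompose p [:e, 1:]) j * poly (coeff D j) e)"
  by (simp add: op_act_def poly_sum poly_higher_pderiv)

lemma pcompose_power: "pcompose (p ^ n) q = pcompose p q ^ n"
  for p q :: "complex poly"
  by (induction n) (simp_all add: pcompose_mult pcompose_1)

lemma ops_hermite_shift:
  "ops (weight (Hermite b)) n = pcompose (ops (weight (Hermite a)) n) [:of_real (a - b), 1:]"
proof -
  define p where "p = ops (weight (Hermite a)) n"
  define S where "S = [:complex_of_real (a - b), 1:]"
  define q where "q = pcompose p S"
  let ?ev = "poly (eigval (delta (Hermite a))) (of_nat n)"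
  have q': "pcompose (pderiv p) S = pderiv q" "pcompose (pderiv (pderiv p)) S = pderiv (pderiv q)"
    by (simp_all add: q_def S_def pderiv_pcompose pderiv_pCons)
  have "op_act p (delta (Hermite a)) = smult ?ev p"
    unfolding p_def by (rule op_act_ops_delta) simp
  hence "pcompose (op_act p (delta (Hermite a))) S = smult ?ev q"
    by (simp only: pcompose_smult q_def)
  also have "op_act p (delta (Hermite a)) = pderiv p * [:2 * of_real a, -2:] + pderiv (pderiv p)"
    by (simp only: delta.simps op_act_order2 mult_zero_right add_0 mult_1_right)
  also have "pcompose \<dots> S = pderiv q * [:2 * of_real b, -2:] + pderiv (pderiv q)"
    unfolding pcompose_add pcompose_mult q' by (simp add: S_def pcompose_pCons)
  also have "\<dots> = op_act q (delta (Hermite b))"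
    by (simp only: delta.simps op_act_order2 mult_zero_right add_0 mult_1_right)
  finally have "op_act q (delta (Hermite b)) = smult (poly (eigval (delta (Hermite b))) (of_nat n)) q"
    by (simp only: eigval_delta)
  hence "q = smult (coeff q n) (ops (weight (Hermite b)) n)"
    by (intro eigenpoly_ops) simp_all
  moreover have "coeff q n = 1"
    using lead_coeff_comp[of S p] coeff_ops[of "Hermite a" n] degree_ops[of "Hermite a" n]
    by (simp add: q_def p_def S_def degree_pcompose del: weight.simps)
  ultimately show ?thesis
    by (simp add: q_def p_def S_def)
qed

text \<open>
  Let $C$ be the polynomial in $\delta_a$ with the same eigenvalue as $D$. Then $p \cdot D$ is the translate of
  $p \cdot C$ by $s = a - b$ for $p = p_n$, hence for all $p$. At a point $x$ the left-hand side involves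
  derivatives of $p$ at $x$ and the right-hand side derivatives at $x + s$, and these can be prescribed
  independently.
\<close>

lemma hermite_intertwiner_zero:
  assumes "a \<noteq> b" and D: "D \<in> intertwiners (Hermite a) (Hermite b)"
  shows "D = 0"
proof -
  define s where "s = complex_of_real (a - b)"
  have "s \<noteq> 0"
    using assms(1) unfolding s_def of_real_eq_0_iff by simp
  have "eigval D \<in> poly_alg (eigval (delta (Hermite a)))"
    unfolding eigval_delta by (simp add: poly_alg_linear)
  then obtain q where q: "eigval D = pcompose q (eigval (delta (Hermite a)))"
    unfolding poly_alg_def by blast
  have "admissible (Hermite a)"
    by simp
  from poly_in_delta[OF this, of q] obtain C where
    C: "C \<in> intertwiners (Hermite a) (Hermite a)" "eigval C = eigval D"
    unfolding q by blast
  have DC: "op_act p D = pcompose (op_act p C) [:s, 1:]" for p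
  proof (rule poly_basis_induct[where b = "ops (weight (Hermite a))" and p = p])
    fix n
    show "ops (weight (Hermite a)) n \<noteq> 0 \<and> degree (ops (weight (Hermite a)) n) = n"
      by (intro conjI ops_nonzero degree_ops) simp_all
    have "op_act (ops (weight (Hermite a)) n) D =
            smult (poly (eigval D) (of_nat n)) (ops (weight (Hermite b)) n)"
      by (rule op_act_intertwiner[OF _ _ D]) simp_all
    also have "\<dots> = pcompose (smult (poly (eigval C) (of_nat n)) (ops (weight (Hermite a)) n)) [:s, 1:]"
      unfolding ops_hermite_shift[of b n a] C(2) pcompose_smult s_def ..
    also have "smult (poly (eigval C) (of_nat n)) (ops (weight (Hermite a)) n) =
               op_act (ops (weight (Hermite a)) n) C"
      by (rule op_act_intertwiner[OF _ _ C(1), symmetric]) simp_all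
    finally show "op_act (ops (weight (Hermite a)) n) D =
                  pcompose (op_act (ops (weight (Hermite a)) n) C) [:s, 1:]" .
  qed (simp_all add: op_act_add_left op_act_smult_left pcompose_add pcompose_smult)
  define m M where "m = degree D" and "M = Suc (degree C)"
  have "poly (coeff D m) x = 0" for x
  proof -
    \<comment> \<open>A zero of order $M$, above the order of $C$, at $x + s$ makes the right-hand side vanish; a zero of order
      $m$ at $x$ isolates the leading coefficient of $D$.\<close>
    define p where "p = [:- x - s, 1:] ^ M * [:- x, 1:] ^ m"
    have at_x: "pcompose p [:x, 1:] = monom 1 m * [:- s, 1:] ^ M"
      by (simp add: p_def pcompose_mult pcompose_power pcompose_pCons monom_altdef)
    have at_xs: "pcompose p [:s + x, 1:] = monom 1 M * [:s, 1:] ^ m"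
      by (simp add: p_def pcompose_mult pcompose_power pcompose_pCons monom_altdef)
    have "poly (op_act p D) x = (\<Sum>j\<le>m. if j = m then fact m * (- s) ^ M * poly (coeff D m) x else 0)"
      unfolding poly_op_act at_x m_def
      by (intro sum.cong refl) (auto simp: coeff_monom_mult coeff_0_power)
    also have "\<dots> = fact m * (- s) ^ M * poly (coeff D m) x"
      by simp
    finally have "fact m * (- s) ^ M * poly (coeff D m) x = poly (op_act p C) (s + x)"
      unfolding DC by (simp add: poly_pcompose)
    also have "\<dots> = 0"
      unfolding poly_op_act at_xs M_def by (intro sum.neutral) (auto simp: coeff_monom_mult)
    finally show ?thesis
      using \<open>s \<noteq> 0\<close> by simp
  qed
  hence "coeff D m = 0"
    using poly_all_0_iff_0 by blast
  thus ?thesis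
    by (simp add: m_def)
qed

text \<open>
  If the eigenvalue is nonzero, the exponents of two Jacobi weights at the two endpoints differ by opposite
  integers, and \<open>rising_factor\<close> is applied at the endpoint where $u$ has the larger exponent.
\<close>

lemma eigval_intertwiner:
  assumes adm: "admissible u" "admissible v" and type: "same_type u v"
    and D: "D \<in> intertwiners u v"
  shows "\<exists>f\<in>poly_alg (eigval (delta v)). eigval D = eigval (T_op u v) * f"
proof (cases "eigval D = 0")
  case True
  thus ?thesis
    using poly_algI[of 0 "eigval (delta v)"] by (intro bexI[of _ 0]) auto
next
  case nz: False
  show ?thesis
  proof (cases u)
    case u: (Hermite a)
    then obtain b where v: "v = Hermite b"
      using type by (cases v) auto
    have "a = b"
      using hermite_intertwiner_zero[of a b D] D nz unfolding u v by (metis eigval_zero)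
    thus ?thesis
      unfolding u v eigval_delta by (simp add: poly_alg_linear)
  next
    case u: (Laguerre a)
    then obtain a' where v: "v = Laguerre a'"
      using type by (cases v) auto
    have a: "a > -1" "a' > -1" using adm by (auto simp: u v)
    show ?thesis
    proof (rule exponent_difference[OF adm _ _ a _ D nz])
      show "endpoint u 0 1 (of_real a) 0 (-1)" "endpoint v 0 1 (of_real a') 0 (-1)"
        unfolding u v by (rule endpoint_laguerre)+
    next
      fix k assume k: "a = a' + real k"
      have "\<exists>f\<in>poly_alg (eigval (delta v)). eigval D = eigval (op_rising [:0, 1:] (of_real a') k) * f"
        by (rule rising_factor[where e = 0 and \<kappa> = 1 and \<epsilon> = 0 and \<eta> = "-1", OF adm _ _ a(2) _ D])
           (use endpoint_laguerre[of a] endpoint_laguerre[of a'] in \<open>simp_all add: u v k\<close>)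
      thus ?thesis
        unfolding u v k T_op_laguerre(2)[OF a(2)] .
    next
      fix k assume k: "a' = a + real k"
      have "eigval D \<in> poly_alg (eigval (delta v))"
        unfolding v eigval_delta by (simp add: poly_alg_linear)
      moreover have "eigval (T_op u v) = 1"
        unfolding u v k T_op_laguerre(1)[OF a(1)] by (rule eigval_op_power)
      ultimately show ?thesis
        by (metis mult_1)
    qed simp
  next
    case u: (Jacobi a b)
    then obtain a' b' where v: "v = Jacobi a' b'"
      using type by (cases v) auto
    have ab: "a > -1" "a' > -1" "b > -1" "b' > -1" using adm by (auto simp: u v)
    have sum: "a + b = a' + b'"
      using jacobi_sum_of_exponents adm D nz unfolding u v by blast
    show ?thesis
    proof (rule exponent_difference[OF adm _ _ ab(3,4) _ D nz])
      show "endpoint u (-1) 2 (of_real b) (-1) (- of_real (a + b + 2))"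
        unfolding u by (rule endpoint_jacobi_left)
      show "endpoint v (-1) 2 (of_real b') (-1) (- of_real (a + b + 2))"
        unfolding v sum by (rule endpoint_jacobi_left)
    next
      fix k assume k: "b = b' + real k"
      hence a': "a' = a + real k" using sum by simp
      have "\<exists>f\<in>poly_alg (eigval (delta v)). eigval D = eigval (op_rising [:1, 1:] (of_real b') k) * f"
        by (rule rising_factor[where e = "-1" and \<kappa> = 2 and \<epsilon> = "-1"
              and \<eta> = "- of_real (a + b + 2)", OF adm _ _ ab(4) _ D])
           (use endpoint_jacobi_left[of a b] endpoint_jacobi_left[of a' b', folded sum] in \<open>simp_all add: u v k\<close>)
      thus ?thesis
        unfolding u v k a' T_op_jacobi(1)[OF ab(1,4)] .
    next
      fix k assume k: "b' = b + real k"
      hence a: "a = a' + real k" using sum by simp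
      have "\<exists>f\<in>poly_alg (eigval (delta v)). eigval D = eigval (op_rising [:-1, 1:] (of_real a') k) * f"
        by (rule rising_factor[where e = 1 and \<kappa> = "-2" and \<epsilon> = "-1"
              and \<eta> = "- of_real (a + b + 2)", OF adm _ _ ab(2) _ D])
           (use endpoint_jacobi_right[of a b] endpoint_jacobi_right[of a' b', folded sum] in \<open>simp_all add: u v a\<close>)
      thus ?thesis
        unfolding u v k a T_op_jacobi(2)[OF ab(2,3)] .
    qed simp
  qed
qed

lemma eigval_intertwiners:
  assumes adm: "admissible u" "admissible v" and type: "same_type u v"
  shows "eigval ` intertwiners u v = {eigval (T_op u v) * f | f. f \<in> poly_alg (eigval (delta v))}"
proof (intro equalityI subsetI)
  fix c assume "c \<in> eigval ` intertwiners u v"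
  thus "c \<in> {eigval (T_op u v) * f | f. f \<in> poly_alg (eigval (delta v))}"
    using eigval_intertwiner[OF assms] by blast
next
  fix c assume "c \<in> {eigval (T_op u v) * f | f. f \<in> poly_alg (eigval (delta v))}"
  then obtain q where c: "c = eigval (T_op u v) * pcompose q (eigval (delta v))"
    by (auto simp: poly_alg_def)
  obtain C where C: "C \<in> intertwiners v v" "eigval C = pcompose q (eigval (delta v))"
    using poly_in_delta[OF adm(2)] by blast
  have "eigval (op_comp (T_op u v) C) = c"
    using T_op_intertwiner[OF assms] C intertwiner_nonraising adm unfolding c by (subst eigval_comp) auto
  thus "c \<in> eigval ` intertwiners u v"
    using intertwiner_comp[OF T_op_intertwiner[OF assms] C(1)] by blast
qed

section \<open>The eigenvalue algebra of a direct sum\<close>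

definition entry :: "'n::finite mdiffop \<Rightarrow> 'n \<Rightarrow> 'n \<Rightarrow> diffop" where
  "entry D a b = map_poly (\<lambda>M. M $ a $ b) D"

lemma coeff_entry: "coeff (entry D a b) k = coeff D k $ a $ b"
  by (simp add: entry_def coeff_map_poly)

lemma degree_entry: "degree (entry D a b) \<le> degree D"
  by (intro degree_le) (simp add: coeff_entry coeff_eq_0)

lemma meigval_entry: "meigval D $ a $ b = eigval (entry D a b)"
  by (simp add: meigval_def eigval_le[OF degree_entry] coeff_entry)

lemma exists_entries:
  fixes E :: "'n::finite \<Rightarrow> 'n \<Rightarrow> diffop"
  shows "\<exists>D. \<forall>a b. entry D a b = E a b"
proof -
  define M where "M = (\<Sum>a\<in>UNIV. \<Sum>b\<in>UNIV. degree (E a b))"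
  have M: "degree (E a b) \<le> M" for a b
  proof -
    have "degree (E a b) \<le> (\<Sum>b\<in>UNIV. degree (E a b))"
      by (intro member_le_sum) auto
    also have "\<dots> \<le> M"
      unfolding M_def by (intro member_le_sum) auto
    finally show ?thesis .
  qed
  define D where "D = (\<Sum>k\<le>M. monom (\<chi> a b. coeff (E a b) k) k)"
  have D: "coeff D k = (if k \<le> M then (\<chi> a b. coeff (E a b) k) else 0)" for k
    by (simp add: D_def coeff_sum)
  have "coeff (entry D a b) k = coeff (E a b) k" for a b k
    using M[of a b] by (simp add: coeff_entry D coeff_eq_0)
  hence "\<forall>a b. entry D a b = E a b"
    by (simp add: poly_eq_iff)
  thus ?thesis ..
qed

lemma mop_act_diag_ops:
  "mop_act (diag_ops w n) D $ a $ b = op_act (ops (weight (w a)) n) (entry D a b)"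
proof -
  have "((\<chi> a b. (pderiv ^^ j) (diag_ops w n $ a $ b)) ** M) $ a $ b =
          (pderiv ^^ j) (ops (weight (w a)) n) * M $ a $ b" for j and M :: "complex poly ^ 'a ^ 'a"
  proof -
    have "((\<chi> a b. (pderiv ^^ j) (diag_ops w n $ a $ b)) ** M) $ a $ b =
          (\<Sum>c\<in>UNIV. if a = c then (pderiv ^^ j) (ops (weight (w a)) n) * M $ a $ b else 0)"
      unfolding matrix_matrix_mult_def vec_lambda_beta
      by (intro sum.cong refl) (auto simp: diag_ops_def)
    thus ?thesis by simp
  qed
  thus ?thesis
    by (simp add: mop_act_def op_act_le[OF degree_entry] coeff_entry)
qed

lemma mp_const_mult_diag_ops:
  "(mp_const L ** diag_ops w n) $ a $ b = smult (L $ a $ b) (ops (weight (w b)) n)"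
proof -
  have "(mp_const L ** diag_ops w n) $ a $ b =
          (\<Sum>c\<in>UNIV. if b = c then smult (L $ a $ b) (ops (weight (w b)) n) else 0)"
    unfolding matrix_matrix_mult_def vec_lambda_beta
    by (intro sum.cong refl) (auto simp: diag_ops_def mp_const_def)
  thus ?thesis by simp
qed

lemma mDalg_direct_sum:
  fixes w :: "'n::finite \<Rightarrow> classical"
  assumes adm: "\<And>i. admissible (w i)"
  shows "D \<in> mDalg (direct_sum (\<lambda>i. weight (w i))) \<longleftrightarrow>
           (\<forall>a b. entry D a b \<in> intertwiners (w a) (w b))"
proof -
  have "mop_act (diag_ops w n) D = mp_const L ** diag_ops w n \<longleftrightarrow>
          (\<forall>a b. op_act (ops (weight (w a)) n) (entry D a b) = smult (L $ a $ b) (ops (weight (w b)) n))"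
    for n L
    by (simp add: vec_eq_iff mop_act_diag_ops mp_const_mult_diag_ops)
  hence iff: "D \<in> mDalg (direct_sum (\<lambda>i. weight (w i))) \<longleftrightarrow>
      (\<forall>n. \<exists>L. \<forall>a b. op_act (ops (weight (w a)) n) (entry D a b) =
                       smult (L $ a $ b) (ops (weight (w b)) n))"
    by (simp add: mDalg_def mops_direct_sum[of w, OF adm])
  show ?thesis
  proof
    assume "D \<in> mDalg (direct_sum (\<lambda>i. weight (w i)))"
    thus "\<forall>a b. entry D a b \<in> intertwiners (w a) (w b)"
      unfolding iff intertwiners_def by blast
  next
    assume D: "\<forall>a b. entry D a b \<in> intertwiners (w a) (w b)"
    show "D \<in> mDalg (direct_sum (\<lambda>i. weight (w i)))"
      unfolding iff
    proof
      fix n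
      have "op_act (ops (weight (w a)) n) (entry D a b) =
              smult ((\<chi> a b. poly (eigval (entry D a b)) (of_nat n)) $ a $ b) (ops (weight (w b)) n)" for a b
        using op_act_intertwiner[OF adm adm] D by simp
      thus "\<exists>L. \<forall>a b. op_act (ops (weight (w a)) n) (entry D a b) =
                        smult (L $ a $ b) (ops (weight (w b)) n)"
        by blast
    qed
  qed
qed

lemma sum_matrix_units:
  fixes g :: "'n::finite \<Rightarrow> 'n \<Rightarrow> complex poly"
  shows "(\<Sum>i\<in>UNIV. \<Sum>j\<in>UNIV. mat (g i j) ** matrix_unit i j) = (\<chi> i j. g i j)"
proof -
  have *: "(mat (g i j) ** matrix_unit i j) $ a $ b = (if b = j then if a = i then g i j else 0 else 0)" for i j a b
  proof -
    have "(mat (g i j) ** matrix_unit i j) $ a $ b =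
            (\<Sum>c\<in>UNIV. if a = c then (if b = j then if a = i then g i j else 0 else 0) else 0)"
      unfolding matrix_matrix_mult_def vec_lambda_beta
      by (intro sum.cong refl) (auto simp: mat_def matrix_unit_def)
    thus ?thesis by simp
  qed
  show ?thesis
    by (simp add: vec_eq_iff *)
qed

text \<open>
  The entries of an operator can be chosen independently, so the description of the eigenvalue algebra
  reduces to \<open>eigval_intertwiners\<close> for each pair of indices.
\<close>

lemma eigenvalue_algebra_direct_sum:
  fixes w :: "'n::finite \<Rightarrow> classical"
  assumes adm: "\<And>i. admissible (w i)"
    and type: "\<And>i j. same_type (w i) (w j)"
  shows "eigenvalue_algebra (direct_sum (\<lambda>i. weight (w i))) =
       {\<Sum>i\<in>UNIV. \<Sum>j\<in>UNIV. mat (eigval (T_op (w i) (w j)) * f i j) ** matrix_unit i j | f.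
          \<forall>i j. f i j \<in> poly_alg (eigval (delta (w j)))}"
proof -
  have scalar: "(\<exists>D\<in>intertwiners (w a) (w b). eigval D = c) \<longleftrightarrow>
      (\<exists>f\<in>poly_alg (eigval (delta (w b))). c = eigval (T_op (w a) (w b)) * f)" for a b c
  proof -
    have "(\<exists>D\<in>intertwiners (w a) (w b). eigval D = c) \<longleftrightarrow> c \<in> eigval ` intertwiners (w a) (w b)"
      by blast
    thus ?thesis
      unfolding eigval_intertwiners[OF adm[of a] adm[of b] type[of a b]] by blast
  qed
  have "M \<in> eigenvalue_algebra (direct_sum (\<lambda>i. weight (w i))) \<longleftrightarrow>
          (\<forall>a b. \<exists>D\<in>intertwiners (w a) (w b). eigval D = M $ a $ b)" for M
  proof
    assume "M \<in> eigenvalue_algebra (direct_sum (\<lambda>i. weight (w i)))"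
    then obtain D where "M = meigval D" "\<forall>a b. entry D a b \<in> intertwiners (w a) (w b)"
      unfolding eigenvalue_algebra_def using mDalg_direct_sum[of w, OF adm] by blast
    thus "\<forall>a b. \<exists>D\<in>intertwiners (w a) (w b). eigval D = M $ a $ b"
      by (auto simp: meigval_entry)
  next
    assume "\<forall>a b. \<exists>D\<in>intertwiners (w a) (w b). eigval D = M $ a $ b"
    then obtain E where E: "E a b \<in> intertwiners (w a) (w b)" "eigval (E a b) = M $ a $ b" for a b
      by metis
    obtain D where D: "\<And>a b. entry D a b = E a b"
      using exists_entries by blast
    have "D \<in> mDalg (direct_sum (\<lambda>i. weight (w i)))"
      unfolding mDalg_direct_sum[of w, OF adm] by (simp add: D E)
    moreover have "M = meigval D"
      by (simp add: vec_eq_iff meigval_entry D E)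
    ultimately show "M \<in> eigenvalue_algebra (direct_sum (\<lambda>i. weight (w i)))"
      unfolding eigenvalue_algebra_def by blast
  qed
  also have "(\<forall>a b. \<exists>D\<in>intertwiners (w a) (w b). eigval D = M $ a $ b) \<longleftrightarrow>
      (\<exists>f. M = (\<chi> a b. eigval (T_op (w a) (w b)) * f a b) \<and>
           (\<forall>a b. f a b \<in> poly_alg (eigval (delta (w b)))))" for M
    unfolding scalar by (simp add: vec_eq_iff) metis
  finally show ?thesis
    unfolding sum_matrix_units by blast
qed

lemma pochhammer_Gamma_ratio:
  assumes "c > -1"
  shows "pochhammer (of_nat n + complex_of_real c + 1) k =
           of_real (Gamma (real n + c + real k + 1) / Gamma (real n + c + 1))"
proof -
  have "real n + c + 1 \<notin> \<int>\<^sub>\<le>\<^sub>0"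
    using assms by (auto elim!: nonpos_Ints_cases)
  hence "pochhammer (real n + c + 1) k = Gamma (real n + c + real k + 1) / Gamma (real n + c + 1)"
    by (simp add: pochhammer_Gamma add_ac)
  thus ?thesis
    using pochhammer_of_real[of "real n + c + 1" k, where ?'a = complex] by simp
qed

theorem theorem6p3:
  fixes w :: "'n::finite \<Rightarrow> classical"
  assumes adm: "\<And>i. admissible (w i)"
    and type: "\<And>i j. same_type (w i) (w j)"
  shows
    "eigenvalue_algebra (direct_sum (\<lambda>i. weight (w i))) =
       {\<Sum>i\<in>UNIV. \<Sum>j\<in>UNIV. mat (eigval (T_op (w i) (w j)) * f i j) ** matrix_unit i j | f.
          \<forall>i j. f i j \<in> poly_alg (eigval (delta (w j)))}
     \<and> (\<forall>b. poly_alg (eigval (delta (Hermite b))) = UNIV)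
     \<and> (\<forall>\<alpha>>-1. poly_alg (eigval (delta (Laguerre \<alpha>))) = UNIV)
     \<and> (\<forall>\<alpha>>-1. \<forall>\<beta>>-1. poly_alg (eigval (delta (Jacobi \<alpha> \<beta>))) =
          poly_alg ([:0, 1:] * [:of_real \<alpha> + of_real \<beta> + 1, 1:]))
     \<and> (\<forall>u. admissible u \<longrightarrow> eigval (T_op u u) = 1)
     \<and> (\<forall>u v. admissible u \<and> admissible v \<and> same_type u v \<and> \<not> darboux (weight u) (weight v) \<longrightarrow>
          eigval (T_op u v) = 0)
     \<and> (\<forall>\<alpha>>-1. \<forall>k. eigval (T_op (Laguerre \<alpha>) (Laguerre (\<alpha> + real k))) = 1
          \<and> (\<forall>n. poly (eigval (T_op (Laguerre (\<alpha> + real k)) (Laguerre \<alpha>))) (of_nat n) =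
               of_real (Gamma (real n + \<alpha> + real k + 1) / Gamma (real n + \<alpha> + 1))))
     \<and> (\<forall>\<alpha>>-1. \<forall>\<beta>>-1. \<forall>k n.
          poly (eigval (T_op (Jacobi \<alpha> (\<beta> + real k)) (Jacobi (\<alpha> + real k) \<beta>))) (of_nat n) =
            of_real (Gamma (real n + \<beta> + real k + 1) / Gamma (real n + \<beta> + 1))
          \<and> poly (eigval (T_op (Jacobi (\<alpha> + real k) \<beta>) (Jacobi \<alpha> (\<beta> + real k)))) (of_nat n) =
            of_real (Gamma (real n + \<alpha> + real k + 1) / Gamma (real n + \<alpha> + 1)))"
proof (intro conjI allI impI)
  show "eigenvalue_algebra (direct_sum (\<lambda>i. weight (w i))) =
       {\<Sum>i\<in>UNIV. \<Sum>j\<in>UNIV. mat (eigval (T_op (w i) (w j)) * f i j) ** matrix_unit i j | f.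
          \<forall>i j. f i j \<in> poly_alg (eigval (delta (w j)))}"
    by (rule eigenvalue_algebra_direct_sum[OF adm type])
next
  fix b show "poly_alg (eigval (delta (Hermite b))) = UNIV"
    unfolding eigval_delta by (simp add: poly_alg_linear)
next
  fix \<alpha> show "poly_alg (eigval (delta (Laguerre \<alpha>))) = UNIV"
    unfolding eigval_delta by (simp add: poly_alg_linear)
next
  fix \<alpha> \<beta>
  have "eigval (delta (Jacobi \<alpha> \<beta>)) = - ([:0, 1:] * [:of_real \<alpha> + of_real \<beta> + 1, 1:])"
    unfolding eigval_delta by simp
  thus "poly_alg (eigval (delta (Jacobi \<alpha> \<beta>))) =
          poly_alg ([:0, 1:] * [:of_real \<alpha> + of_real \<beta> + 1, 1:])"
    by (simp only: poly_alg_minus)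
next
  fix u show "eigval (T_op u u) = 1"
    by simp
next
  fix u v
  assume *: "admissible u \<and> admissible v \<and> same_type u v \<and> \<not> darboux (weight u) (weight v)"
  hence "u \<noteq> v"
    using darboux_refl by blast
  thus "eigval (T_op u v) = 0"
    using * by (simp add: T_op_def)
next
  fix \<alpha> :: real and k :: nat
  assume "\<alpha> > -1"
  thus "eigval (T_op (Laguerre \<alpha>) (Laguerre (\<alpha> + real k))) = 1"
    by (simp only: T_op_laguerre eigval_op_power)
next
  fix \<alpha> :: real and k n :: nat
  assume "\<alpha> > -1"
  thus "poly (eigval (T_op (Laguerre (\<alpha> + real k)) (Laguerre \<alpha>))) (of_nat n) =
          of_real (Gamma (real n + \<alpha> + real k + 1) / Gamma (real n + \<alpha> + 1))"
    by (simp only: T_op_laguerre poly_eigval_op_rising pochhammer_Gamma_ratio)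
next
  fix \<alpha> \<beta> :: real and k n :: nat
  assume "\<alpha> > -1" "\<beta> > -1"
  thus "poly (eigval (T_op (Jacobi \<alpha> (\<beta> + real k)) (Jacobi (\<alpha> + real k) \<beta>))) (of_nat n) =
            of_real (Gamma (real n + \<beta> + real k + 1) / Gamma (real n + \<beta> + 1))"
    and "poly (eigval (T_op (Jacobi (\<alpha> + real k) \<beta>) (Jacobi \<alpha> (\<beta> + real k)))) (of_nat n) =
            of_real (Gamma (real n + \<alpha> + real k + 1) / Gamma (real n + \<alpha> + 1))"
    by (simp_all only: T_op_jacobi poly_eigval_op_rising pochhammer_Gamma_ratio)
qed

end
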